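(* There exists an algebra homomorphism $\gamma: \mathcal U^+_q \to U^+_q$ that sends $$\mathcal W_{-n} \mapsto W_{-n},\qquad \mathcal W_{n+1} \mapsto W_{n+1},\qquad \mathcal G_{n} \mapsto G_{n},\qquad \mathcal {\tilde G}_{n} \mapsto \tilde G_{n}$$ for $n \in \mathbb N$. Moreover $\gamma$ is surjective.
   Context: Let $\mathbb F$ be a field and fix a nonzero $q\in\mathbb F$ that is not a root of unity. $\mathbb N=\{0,1,2,\ldots\}$. All algebras are associative, over $\mathbb F$, with multiplicative identity. For elements $X,Y$ of an algebra, $[X,Y]=XY-YX$, and $[X,Y]_q=qXY-q^{-1}YX$ (so $[X,Y]_{q^{-1}}=q^{-1}XY-qYX$). The algebra $U^+_q$ is defined by generators $A,B$ and the relations $[A,[A,[A,B]_q]_{q^{-1}}]=0$, $[B,[B,[B,A]_q]_{q^{-1}}]=0$. Its alternating elements $W_{-k}, W_{k+1}, G_{k+1}, \tilde G_{k+1}$ ($k\in\mathbb N$) are the elements determined recursively, in the order $W_0,W_1,G_1,\tilde G_1,W_{-1},W_2,G_2,\tilde G_2,W_{-2},W_3,\ldots$, by $W_0=A$, $W_1=B$, and for $n\ge 1$ $$G_n = \frac{q\sum_{k=0}^{n-1} W_{-k} W_{n-k} q^{n-1-2k}-\sum_{k=1}^{n-1} G_k \tilde G_{n-k} q^{n-2k}}{q^n+q^{-n}}+\frac{W_n W_0-W_0 W_n}{(1+q^{-2n})(1-q^{-2})},$$ $$\tilde G_n = G_n + \frac{W_0 W_n-W_n W_0}{1-q^{-2}},\quad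 W_{-n} = \frac{q W_0 G_n - q^{-1} G_n W_0}{q-q^{-1}},\quad W_{n+1} = \frac{q G_n W_1 - q^{-1} W_1 G_n}{q-q^{-1}}.$$ Also $G_0=\tilde G_0=1$. The algebra $\mathcal U^+_q$ is defined by generators (called alternating generators) $\mathcal W_{-k}, \mathcal W_{k+1}, \mathcal G_{k+1}, \mathcal{\tilde G}_{k+1}$ ($k\in\mathbb N$) and the following relations for all $k,\ell\in\mathbb N$: $[\mathcal W_0,\mathcal W_{k+1}]=[\mathcal W_{-k},\mathcal W_1]=(1-q^{-2})(\mathcal{\tilde G}_{k+1}-\mathcal G_{k+1})$; $[\mathcal W_0,\mathcal G_{k+1}]_q=[\mathcal{\tilde G}_{k+1},\mathcal W_0]_q=(q-q^{-1})\mathcal W_{-k-1}$; $[\mathcal G_{k+1},\mathcal W_1]_q=[\mathcal W_1,\mathcal{\tilde G}_{k+1}]_q=(q-q^{-1})\mathcal W_{k+2}$; $[\mathcal W_{-k},\mathcal W_{-\ell}]=0$; $[\mathcal W_{k+1},\mathcal W_{\ell+1}]=0$; $[\mathcal W_{-k},\mathcal W_{\ell+1}]+[\mathcal W_{k+1},\mathcal W_{-\ell}]=0$; $[\mathcal W_{-k},\mathcal G_{\ell+1}]+[\mathcal G_{k+1},\mathcal W_{-\ell}]=0$; $[\mathcal W_{-k},\mathcal{\tilde G}_{\ell+1}]+[\mathcal{\tilde G}_{k+1},\mathcal W_{-\ell}]=0$; $[\mathcal W_{k+1},\mathcal G_{\ell+1}]+[\mathcal G_{k+1},\mathcal W_{\ell+1}]=0$;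 $[\mathcal W_{k+1},\mathcal{\tilde G}_{\ell+1}]+[\mathcal{\tilde G}_{k+1},\mathcal W_{\ell+1}]=0$; $[\mathcal G_{k+1},\mathcal G_{\ell+1}]=0$; $[\mathcal{\tilde G}_{k+1},\mathcal{\tilde G}_{\ell+1}]=0$; $[\mathcal{\tilde G}_{k+1},\mathcal G_{\ell+1}]+[\mathcal G_{k+1},\mathcal{\tilde G}_{\ell+1}]=0$. Also $\mathcal G_0=\mathcal{\tilde G}_0=1$. *)

theory Defs
  imports "HOL-Algebra.Algebra" "HOL-Library.Poly_Mapping"
begin

section \<open>Free algebras and presentations\<close>

text \<open>
  Words form a noncommutative monoid under concatenation, written additively because the
  convolution product on \<^typ>\<open>'x \<Rightarrow>\<^sub>0 'f\<close> expects an additive monoid of exponents.  The monoid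
  algebra of words over \<^typ>\<open>'f\<close> is the free associative unital algebra on \<^typ>\<open>'x\<close>.
\<close>

datatype 'x word = Word (letters: "'x list")

instantiation word :: (type) monoid_add
begin

definition zero_word :: "'a word" where "0 = Word []"

definition plus_word :: "'a word \<Rightarrow> 'a word \<Rightarrow> 'a word"
  where "v + w = Word (letters v @ letters w)"

instance
  by standard (auto simp: zero_word_def plus_word_def)

end

definition scal :: "'f::field \<Rightarrow> 'x word \<Rightarrow>\<^sub>0 'f"
  where "scal c = Poly_Mapping.single 0 c"

definition gen :: "'x \<Rightarrow> 'x word \<Rightarrow>\<^sub>0 'f::field"
  where "gen x = Poly_Mapping.single (Word [x]) 1"

definition free_alg :: "('f::field, 'x word \<Rightarrow>\<^sub>0 'f) module"
  where "free_alg =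
    \<lparr>carrier = UNIV, monoid.mult = (*), one = 1, ring.zero = 0, add = (+), smult = (\<lambda>c x. scal c * x)\<rparr>"

text \<open>A pair \<open>(l, r)\<close> stands for the relation \<open>l = r\<close>.\<close>

type_synonym ('f, 'x) relations = "(('x word \<Rightarrow>\<^sub>0 'f) \<times> ('x word \<Rightarrow>\<^sub>0 'f)) set"

definition rel_ideal :: "('f::field, 'x) relations \<Rightarrow> ('x word \<Rightarrow>\<^sub>0 'f) set"
  where "rel_ideal S = Idl\<^bsub>free_alg\<^esub> {l - r | l r. (l, r) \<in> S}"

definition coset :: "('f::field, 'x) relations \<Rightarrow> ('x word \<Rightarrow>\<^sub>0 'f) \<Rightarrow> ('x word \<Rightarrow>\<^sub>0 'f) set"
  where "coset S p = rel_ideal S +>\<^bsub>free_alg\<^esub> p"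

text \<open>
  The quotient ring of the free algebra, equipped with the induced scalar multiplication (the union
  is over representatives, as in \<^const>\<open>rcoset_mult\<close>; see \<open>smult_coset\<close> below).
\<close>

definition presented_alg :: "('f::field, 'x) relations \<Rightarrow> ('f, ('x word \<Rightarrow>\<^sub>0 'f) set) module"
  where "presented_alg S =
    ring.extend (free_alg Quot rel_ideal S)
      (module.fields (\<lambda>c P. \<Union>x\<in>P. coset S (c \<odot>\<^bsub>free_alg\<^esub> x)))"

definition alg_hom :: "('f, 'a, 'm) module_scheme \<Rightarrow> ('f, 'b, 'n) module_scheme \<Rightarrow> ('a \<Rightarrow> 'b) set"
  where "alg_hom U V =
    {h \<in> ring_hom U V. \<forall>c. \<forall>x\<in>carrier U. h (c \<odot>\<^bsub>U\<^esub> x) = c \<odot>\<^bsub>V\<^esub> h x}"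

lemma ring_free_alg: "ring (free_alg :: ('f::field, 'x word \<Rightarrow>\<^sub>0 'f) module)"
proof (rule ringI)
  show "abelian_group (free_alg :: ('f, 'x word \<Rightarrow>\<^sub>0 'f) module)"
  proof (rule abelian_groupI)
    fix x :: "'x word \<Rightarrow>\<^sub>0 'f"
    show "\<exists>y\<in>carrier free_alg. y \<oplus>\<^bsub>free_alg\<^esub> x = \<zero>\<^bsub>free_alg\<^esub>"
      by (rule bexI[of _ "- x"]) (simp_all add: free_alg_def)
  qed (auto simp: free_alg_def algebra_simps)
  show "monoid (free_alg :: ('f, 'x word \<Rightarrow>\<^sub>0 'f) module)"
    by (rule monoidI) (auto simp: free_alg_def algebra_simps)
qed (auto simp: free_alg_def algebra_simps)

lemma ideal_rel_ideal: "ideal (rel_ideal S) free_alg"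
  unfolding rel_ideal_def
  by (rule ring.genideal_ideal[OF ring_free_alg]) (simp add: free_alg_def)

lemma smult_coset: "c \<odot>\<^bsub>presented_alg S\<^esub> coset S p = coset S (scal c * p)"
proof -
  interpret ideal "rel_ideal S" free_alg by (rule ideal_rel_ideal)
  have *: "coset S (scal c * x) = coset S (scal c * p)" if x: "x \<in> coset S p" for x
  proof -
    obtain h where h: "h \<in> rel_ideal S" "x = h + p"
      using x by (auto simp: coset_def a_r_coset_def r_coset_def free_alg_def)
    have "scal c * h \<in> rel_ideal S"
      using I_l_closed[OF h(1), of "scal c"] by (simp add: free_alg_def)
    moreover have "scal c * x = scal c * h + scal c * p"
      by (simp add: h(2) distrib_left)
    ultimately have "scal c * x \<in> coset S (scal c * p)"
      by (auto simp: coset_def a_r_coset_def r_coset_def free_alg_def)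
    then show ?thesis
      unfolding coset_def by (intro a_repr_independence'[symmetric]) (auto simp: free_alg_def)
  qed
  have "p \<in> coset S p"
    unfolding coset_def by (rule a_rcos_self) (simp add: free_alg_def)
  then have "(\<Union>x\<in>coset S p. coset S (scal c * x)) = coset S (scal c * p)"
    using * by (metis (no_types, lifting) SUP_eq_const empty_iff)
  then show ?thesis
    by (simp add: presented_alg_def ring.defs module.defs free_alg_def)
qed


section \<open>The algebra \<open>U\<^sup>+\<^sub>q\<close>\<close>

definition comm :: "'a::ring_1 \<Rightarrow> 'a \<Rightarrow> 'a"
  where "comm x y = x * y - y * x"

definition qcomm :: "'f::field \<Rightarrow> ('x word \<Rightarrow>\<^sub>0 'f) \<Rightarrow> ('x word \<Rightarrow>\<^sub>0 'f) \<Rightarrow> ('x word \<Rightarrow>\<^sub>0 'f)"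
  where "qcomm q x y = scal q * (x * y) - scal (inverse q) * (y * x)"

datatype plus_gen = Agen | Bgen

definition plus_rels :: "'f::field \<Rightarrow> ('f, plus_gen) relations"
  where "plus_rels q =
    (let A = gen Agen; B = gen Bgen in
     {(comm A (qcomm (inverse q) A (qcomm q A B)), 0),
      (comm B (qcomm (inverse q) B (qcomm q B A)), 0)})"

definition Uq_plus :: "'f::field \<Rightarrow> ('f, (plus_gen word \<Rightarrow>\<^sub>0 'f) set) module"
  where "Uq_plus q = presented_alg (plus_rels q)"

definition Uq_A :: "'f::field \<Rightarrow> (plus_gen word \<Rightarrow>\<^sub>0 'f) set"
  where "Uq_A q = coset (plus_rels q) (gen Agen)"

definition Uq_B :: "'f::field \<Rightarrow> (plus_gen word \<Rightarrow>\<^sub>0 'f) set"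
  where "Uq_B q = coset (plus_rels q) (gen Bgen)"


section \<open>Alternating elements\<close>

text \<open>Needed by \<open>function\<close> to see the recursive calls under the sum.\<close>

lemma finsum_fundef_cong [fundef_cong]:
  assumes "A = B" "\<And>x. x \<in> B \<Longrightarrow> f x = g x"
  shows "finsum G f A = finsum G g B"
proof -
  have sub: "(C, z) \<in> foldSetD D k e"
    if "(C, z) \<in> foldSetD D h e" "\<And>x. x \<in> C \<Longrightarrow> h x = k x"
    for C z D e and h k :: "'a \<Rightarrow> 'b \<Rightarrow> 'b"
    using that
  proof (induction rule: foldSetD.induct)
    case emptyI
    show ?case using emptyI(1) by (rule foldSetD.emptyI)
  next
    case (insertI x A y)
    then have "(insert x A, k x y) \<in> foldSetD D k e"
      by (metis foldSetD.insertI insertCI)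
    then show ?case using insertI by simp
  qed
  have "(B, z) \<in> foldSetD D (m \<circ> f) e \<longleftrightarrow> (B, z) \<in> foldSetD D (m \<circ> g) e"
    for z D e and m :: "'b \<Rightarrow> 'b \<Rightarrow> 'b"
    using sub[of B z D "m \<circ> f" e "m \<circ> g"] sub[of B z D "m \<circ> g" e "m \<circ> f"] assms(2)
    by auto
  then show ?thesis
    by (simp add: finsum_def finprod_def foldD_def assms(1))
qed

text \<open>
  The recursion, in an arbitrary algebra with chosen elements \<open>a = W\<^sub>0\<close> and \<open>b = W\<^sub>1\<close>.  The integer
  index of \<open>W\<close> is split in two: \<open>Wneg_rec n\<close> is \<open>W\<close> at index \<open>-n\<close> and \<open>Wpos_rec n\<close> is \<open>W\<close> at
  index \<open>n + 1\<close>, so \<open>W\<close> at index \<open>n - k\<close> is \<open>Wpos_rec (n - k - 1)\<close> when \<open>k < n\<close>.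
\<close>

context
  fixes q :: "'f::field" and U :: "('f, 'a, 'm) module_scheme" (structure) and a b :: 'a
begin

function (sequential) G_rec Gt_rec Wneg_rec Wpos_rec :: "nat \<Rightarrow> 'a" where
  "G_rec n = (if n = 0 then \<one> else
     inverse (q powi int n + q powi (- int n)) \<odot>
       (q \<odot> (\<Oplus>k\<in>{0..<n}. (q powi (int n - 1 - 2 * int k)) \<odot> (Wneg_rec k \<otimes> Wpos_rec (n - k - 1)))
        \<ominus> (\<Oplus>k\<in>{1..<n}. (q powi (int n - 2 * int k)) \<odot> (G_rec k \<otimes> Gt_rec (n - k))))
     \<oplus> inverse ((1 + q powi (- 2 * int n)) * (1 - q powi (-2))) \<odot>
       (Wpos_rec (n - 1) \<otimes> a \<ominus> a \<otimes> Wpos_rec (n - 1)))"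
| "Gt_rec n = (if n = 0 then \<one> else
     G_rec n \<oplus> inverse (1 - q powi (-2)) \<odot>
       (a \<otimes> Wpos_rec (n - 1) \<ominus> Wpos_rec (n - 1) \<otimes> a))"
| "Wneg_rec n = (if n = 0 then a else
     inverse (q - inverse q) \<odot> (q \<odot> (a \<otimes> G_rec n) \<ominus> inverse q \<odot> (G_rec n \<otimes> a)))"
| "Wpos_rec n = (if n = 0 then b else
     inverse (q - inverse q) \<odot> (q \<odot> (G_rec n \<otimes> b) \<ominus> inverse q \<odot> (b \<otimes> G_rec n)))"
  by pat_completeness auto
termination
  by (relation "measure (\<lambda>x. case x of
        Inl (Inl n) \<Rightarrow> 2 * n | Inl (Inr n) \<Rightarrow> 2 * n + 1
      | Inr (Inl n) \<Rightarrow> 2 * n + 1 | Inr (Inr n) \<Rightarrow> 2 * n + 1)") auto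

declare G_rec.simps [simp del] Gt_rec.simps [simp del]
  Wneg_rec.simps [simp del] Wpos_rec.simps [simp del]

end

definition altWneg :: "'f::field \<Rightarrow> nat \<Rightarrow> (plus_gen word \<Rightarrow>\<^sub>0 'f) set"
  where "altWneg q n = Wneg_rec q (Uq_plus q) (Uq_A q) (Uq_B q) n"

definition altWpos :: "'f::field \<Rightarrow> nat \<Rightarrow> (plus_gen word \<Rightarrow>\<^sub>0 'f) set"
  where "altWpos q n = Wpos_rec q (Uq_plus q) (Uq_A q) (Uq_B q) n"

definition altG :: "'f::field \<Rightarrow> nat \<Rightarrow> (plus_gen word \<Rightarrow>\<^sub>0 'f) set"
  where "altG q n = G_rec q (Uq_plus q) (Uq_A q) (Uq_B q) n"

definition altGt :: "'f::field \<Rightarrow> nat \<Rightarrow> (plus_gen word \<Rightarrow>\<^sub>0 'f) set"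
  where "altGt q n = Gt_rec q (Uq_plus q) (Uq_A q) (Uq_B q) n"


section \<open>The algebra on the alternating generators\<close>

text \<open>
  Constructor arguments are offsets: \<open>WnegGen k\<close>, \<open>WposGen k\<close>, \<open>GGen k\<close>, \<open>GtGen k\<close> have indices
  \<open>-k\<close>, \<open>k + 1\<close>, \<open>k + 1\<close>, \<open>k + 1\<close>.
\<close>

datatype alt_gen = WnegGen nat | WposGen nat | GGen nat | GtGen nat

definition alt_rels :: "'f::field \<Rightarrow> ('f, alt_gen) relations"
  where "alt_rels q =
    (let Wm = (\<lambda>k. gen (WnegGen k)); Wp = (\<lambda>k. gen (WposGen k));
         G = (\<lambda>k. gen (GGen k)); Gt = (\<lambda>k. gen (GtGen k)) in
     (\<Union>k.
       {(comm (Wm 0) (Wp k), scal (1 - q powi (-2)) * (Gt k - G k)),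
        (comm (Wm k) (Wp 0), scal (1 - q powi (-2)) * (Gt k - G k)),
        (qcomm q (Wm 0) (G k), scal (q - inverse q) * Wm (k + 1)),
        (qcomm q (Gt k) (Wm 0), scal (q - inverse q) * Wm (k + 1)),
        (qcomm q (G k) (Wp 0), scal (q - inverse q) * Wp (k + 1)),
        (qcomm q (Wp 0) (Gt k), scal (q - inverse q) * Wp (k + 1))}) \<union>
     (\<Union>k l.
       {(comm (Wm k) (Wm l), 0),
        (comm (Wp k) (Wp l), 0),
        (comm (Wm k) (Wp l) + comm (Wp k) (Wm l), 0),
        (comm (Wm k) (G l) + comm (G k) (Wm l), 0),
        (comm (Wm k) (Gt l) + comm (Gt k) (Wm l), 0),
        (comm (Wp k) (G l) + comm (G k) (Wp l), 0),
        (comm (Wp k) (Gt l) + comm (Gt k) (Wp l), 0),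
        (comm (G k) (G l), 0),
        (comm (Gt k) (Gt l), 0),
        (comm (Gt k) (G l) + comm (G k) (Gt l), 0)}))"

definition Uq_alt :: "'f::field \<Rightarrow> ('f, (alt_gen word \<Rightarrow>\<^sub>0 'f) set) module"
  where "Uq_alt q = presented_alg (alt_rels q)"

definition calWneg :: "'f::field \<Rightarrow> nat \<Rightarrow> (alt_gen word \<Rightarrow>\<^sub>0 'f) set"
  where "calWneg q n = coset (alt_rels q) (gen (WnegGen n))"

definition calWpos :: "'f::field \<Rightarrow> nat \<Rightarrow> (alt_gen word \<Rightarrow>\<^sub>0 'f) set"
  where "calWpos q n = coset (alt_rels q) (gen (WposGen n))"

definition calG :: "'f::field \<Rightarrow> nat \<Rightarrow> (alt_gen word \<Rightarrow>\<^sub>0 'f) set"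
  where "calG q n = (case n of 0 \<Rightarrow> \<one>\<^bsub>Uq_alt q\<^esub> | Suc k \<Rightarrow> coset (alt_rels q) (gen (GGen k)))"

definition calGt :: "'f::field \<Rightarrow> nat \<Rightarrow> (alt_gen word \<Rightarrow>\<^sub>0 'f) set"
  where "calGt q n = (case n of 0 \<Rightarrow> \<one>\<^bsub>Uq_alt q\<^esub> | Suc k \<Rightarrow> coset (alt_rels q) (gen (GtGen k)))"

end

theory Submission
  imports Defs "HOL-Computational_Algebra.Formal_Power_Series"
begin

unbundle fps_syntax

text \<open>
  The \<open>q\<close>-Serre relations are first turned into Drinfeld-type relations.  With \<open>x\<^sub>0 = B\<close>, \<open>y\<^sub>0 = A\<close>
  and \<open>f\<^sub>1 = BA - q\<^sup>2AB\<close>, bracketing with \<open>f\<^sub>1\<close> defines \<open>x\<^sub>i\<close>, \<open>y\<^sub>i\<close>; then \<open>x\<^sub>iy\<^sub>j - q\<^sup>2y\<^sub>jx\<^sub>i\<close> depends only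
  on \<open>i + j\<close>, and the resulting elements \<open>f\<^sub>k\<close> commute.  Both claims are proved together by induction: the
  commutators \<open>[f\<^sub>j, f\<^sub>N\<^sub>-\<^sub>j]\<close> satisfy a three-term linear recurrence in \<open>j\<close> that, since \<open>q\<close> is not a root of
  unity, has no nonzero antisymmetric solution.

  Normalise \<open>f\<close> to a series \<open>p(z)\<close> with \<open>p(0) = 1\<close> and solve \<open>a(qz)a(q\<^sup>-\<^sup>1z)p(z) = 1\<close>.  This \<open>a(z)\<close> is the
  generating function of the elements with a tilde, \<open>W\<^sup>+(z) = a(z)X(qz)\<close> with \<open>X(z) = \<Sum>x\<^sub>iz\<^sup>i\<close>, similarly for
  \<open>W\<^sup>-\<close> and \<open>y\<close>, and \<open>G(z) = a(z)p(qz) + q\<^sup>2zW\<^sup>-(z)X(qz)\<close>.  Exchange relations for \<open>a\<close> and \<open>X\<close> give half of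
  the defining relations, together with the quantum determinant identity
  \<open>G(q\<^sup>-\<^sup>1z)a(qz) = 1 + qzW\<^sup>-(q\<^sup>-\<^sup>1z)W\<^sup>+(qz)\<close>, which is the recursion for \<open>G\<^sub>n\<close>, and a companion of it.  By
  the companion, exchanging \<open>A\<close> and \<open>B\<close> exchanges \<open>G\<close> with \<open>a\<close> and \<open>W\<^sup>-\<close> with \<open>W\<^sup>+\<close>, and this gives the
  remaining relations.
\<close>

section \<open>Central scalars\<close>

locale central_unit =
  fixes Q P :: "'a::ring_1"
  assumes Q_comm: "x * Q = Q * x" and P_comm: "x * P = P * x" and QP: "Q * P = 1"
begin

text \<open>As simp rules these move \<open>Q\<close> and \<open>P\<close> to the left and cancel
  them against each other, so together with \<open>algebra_simps\<close> they normalise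
  noncommutative polynomials with such coefficients.\<close>

lemma cent [simp]:
  "P * Q = 1" "Q * P = 1" "P * (Q * z) = z" "Q * (P * z) = z"
  "NO_MATCH Q y \<Longrightarrow> NO_MATCH P y \<Longrightarrow> y * Q = Q * y"
  "NO_MATCH Q y \<Longrightarrow> NO_MATCH P y \<Longrightarrow> y * P = P * y"
  "NO_MATCH Q y \<Longrightarrow> NO_MATCH P y \<Longrightarrow> y * (Q * z) = Q * (y * z)"
  "NO_MATCH Q y \<Longrightarrow> NO_MATCH P y \<Longrightarrow> y * (P * z) = P * (y * z)"
  using Q_comm P_comm QP by (metis mult.assoc mult_1_left)+

text \<open>The difference of the sides is a two-sided combination of the relation between
  \<open>x0\<close> and \<open>x1\<close>. With \<open>y = y l\<close> it computes the bracket of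
  \<open>F 1 l\<close> with \<open>x 0\<close>.\<close>

lemma bracket_root_x:
  assumes "x1 * x0 = Q * Q * x0 * x1"
  shows "(x1*y - Q*Q*y*x1)*x0 - x0*(x1*y - Q*Q*y*x1) =
    Q*Q*(x0*y - Q*Q*y*x0)*x1 - P*P*x1*(x0*y - Q*Q*y*x0)"
proof -
  have "(x1*y - Q*Q*y*x1)*x0 - x0*(x1*y - Q*Q*y*x1) -
    (Q*Q*(x0*y - Q*Q*y*x0)*x1 - P*P*x1*(x0*y - Q*Q*y*x0))
    = P*P*(x1*x0 - Q*Q*x0*x1)*y - Q*Q*y*(x1*x0 - Q*Q*x0*x1)"
    by (simp add: algebra_simps)
  then show ?thesis using assms by simp
qed

text \<open>Distributing the commutator with \<open>m\<close> over \<open>x\<close> and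
  \<open>y\<close> expresses it through \<open>m1\<close> and \<open>m2\<close>. With
  \<open>f (j + 2)\<close>, \<open>f (j + 1)\<close>, \<open>f j\<close> for \<open>m\<close>,
  \<open>m1\<close>, \<open>m2\<close> this is the source of the three-term recurrence.\<close>

lemma bracket_imaginary:
  assumes "m*x - x*m = Q*Q*m1*x1 - P*P*x1*m1"
    and "m*y - y*m = P*P*m1*y1 - Q*Q*y1*m1"
    and "m1*x - x*m1 = Q*Q*m2*x1 - P*P*x1*m2"
    and "m1*y - y*m1 = P*P*m2*y1 - Q*Q*y1*m2"
    and "x1*y - Q*Q*y*x1 = F1" "x*y1 - Q*Q*y1*x = F1"
  shows "m*(x*y - Q*Q*y*x) - (x*y - Q*Q*y*x)*m = (Q*Q+P*P)*(m1*F1 - F1*m1)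
     - (m2*(x1*y1-Q*Q*y1*x1) - (x1*y1-Q*Q*y1*x1)*m2)"
proof -
  \<comment> \<open>Each auxiliary element is the defect of one assumption; the claim is an explicit
    combination of them.\<close>
  define d1 where "d1 = m*x - x*m - (Q*Q*m1*x1 - P*P*x1*m1)"
  define d2 where "d2 = m*y - y*m - (P*P*m1*y1 - Q*Q*y1*m1)"
  define d3 where "d3 = m1*x - x*m1 - (Q*Q*m2*x1 - P*P*x1*m2)"
  define d4 where "d4 = m1*y - y*m1 - (P*P*m2*y1 - Q*Q*y1*m2)"
  define G where "G = x*y1 - Q*Q*y1*x - F1"
  define H where "H = x1*y - Q*Q*y*x1 - F1"
  have z: "d1 = 0" "d2 = 0" "d3 = 0" "d4 = 0" "G = 0" "H = 0"
    using assms by (auto simp: d1_def d2_def d3_def d4_def G_def H_def)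
  have "m*(x*y - Q*Q*y*x) - (x*y - Q*Q*y*x)*m - ((Q*Q+P*P)*(m1*F1 - F1*m1)
     - (m2*(x1*y1-Q*Q*y1*x1) - (x1*y1-Q*Q*y1*x1)*m2)) = 
    d1*y + x*d2 - Q*Q*d2*x - Q*Q*y*d1 + Q*Q*Q*Q*d4*x1 - P*P*x1*d4 - P*P*d3*y1 + Q*Q*Q*Q*y1*d3
    + Q*Q*m1*H - P*P*H*m1 + P*P*m1*G - Q*Q*G*m1"
    unfolding d1_def d2_def d3_def d4_def G_def H_def by (simp add: algebra_simps)
  then show ?thesis unfolding z by simp
qed

lemma bracket_root_y:
  assumes "y0 * y1 = Q * Q * y1 * y0"
  shows "(x*y1 - Q*Q*y1*x)*y0 - y0*(x*y1 - Q*Q*y1*x) =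
    P*P*(x*y0 - Q*Q*y0*x)*y1 - Q*Q*y1*(x*y0 - Q*Q*y0*x)"
proof -
  have "(x*y1 - Q*Q*y1*x)*y0 - y0*(x*y1 - Q*Q*y1*x) -
    (P*P*(x*y0 - Q*Q*y0*x)*y1 - Q*Q*y1*(x*y0 - Q*Q*y0*x))
    = Q*Q*(y0*y1 - Q*Q*y1*y0)*x - P*P*x*(y0*y1 - Q*Q*y1*y0)"
    by (simp add: algebra_simps)
  then show ?thesis using assms by simp
qed

text \<open>Bracketing the known relation with \<open>g\<close> raises the index of
  \<open>x\<close>, because \<open>g\<close> commutes with \<open>h\<close> and \<open>k\<close>.
  The factor \<open>c\<close> stays, since cancelling it needs invertibility.\<close>

lemma bracket_shift:
  assumes "\<And>z. z * c = c * z" and "g * h = h * g" "g * k = k * g"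
    and "h*x - x*h = Q*Q*k*x1 - P*P*x1*k"
    and "g*x - x*g = c*x1" "g*x1 - x1*g = c*x2"
  shows "c * (h*x1 - x1*h - (Q*Q*k*x2 - P*P*x2*k)) = 0"
proof -
  have c: "h * (c * z) = c * (h * z)" "k * (c * z) = c * (k * z)" for z
    using assms(1) by (metis mult.assoc)+
  have "c * (h*x1 - x1*h - (Q*Q*k*x2 - P*P*x2*k)) = h*(c*x1) - (c*x1)*h - Q*Q*k*(c*x2) + P*P*(c*x2)*k"
    by (simp add: algebra_simps c)
  also have "\<dots> = g*(h*x - x*h) - (h*x - x*h)*g + (h*g-g*h)*x + x*(g*h-h*g) - Q*Q*k*(g*x1 - x1*g) + P*P*(g*x1 - x1*g)*k"
    unfolding assms(5,6)[symmetric] by (simp add: algebra_simps)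
  also have "\<dots> = Q*Q*(g*k-k*g)*x1 - P*P*x1*(g*k-k*g)"
    unfolding assms(4) using assms(2) by (simp add: algebra_simps)
  finally show ?thesis using assms(3) by simp
qed

end

section \<open>Scalars of the ground field and powers of \<open>q\<close>\<close>

locale scalars =
  fixes s :: "'f::field \<Rightarrow> 'a::ring_1"
  assumes s_add: "s (c + d) = s c + s d" and s_mult: "s (c * d) = s c * s d"
    and s_1: "s 1 = 1" and s_comm: "x * s c = s c * x"
begin

lemma s_0: "s 0 = 0" using s_add[of 0 0] by simp
lemma s_minus: "s (- c) = - s c" using s_add[of c "-c"] s_0 by (simp add: eq_neg_iff_add_eq_0 add.commute)
lemma s_diff: "s (c - d) = s c - s d" using s_add[of c "-d"] s_minus by simp
lemma s_cancel: "c \<noteq> 0 \<Longrightarrow> s c * x = 0 \<Longrightarrow> x = 0"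
proof -
  assume "c \<noteq> 0" "s c * x = 0"
  then have "s (inverse c) * s c * x = 0" by (simp add: mult.assoc)
  then show "x = 0" using \<open>c \<noteq> 0\<close> by (simp add: s_1 flip: s_mult)
qed

lemma s_inverse_cancel: "c \<noteq> 0 \<Longrightarrow> s c * (s (inverse c) * z) = z"
  and s_inverse_cancel': "c \<noteq> 0 \<Longrightarrow> s (inverse c) * (s c * z) = z"
  by (simp_all add: s_1 flip: mult.assoc s_mult)

lemma s_cancel_eq: "c \<noteq> 0 \<Longrightarrow> s c * (x - y) = 0 \<Longrightarrow> x = y"
  using s_cancel[of c "x - y"] by simp

end

locale qscalars = scalars s for s :: "'f::field \<Rightarrow> 'a::ring_1" +
  fixes q :: 'f
  assumes q0: "q \<noteq> 0" and q_root: "n > 0 \<Longrightarrow> q ^ n \<noteq> 1"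
begin

sublocale central_unit "s q" "s (inverse q)"
proof
  show "z * s q = s q * z" "z * s (inverse q) = s (inverse q) * z" for z by (rule s_comm)+
  show "s q * s (inverse q) = 1" using q0 by (simp add: s_1 flip: s_mult)
qed

abbreviation Q where "Q \<equiv> s q"
abbreviation P where "P \<equiv> s (inverse q)"

lemma q_diff: "n > 0 \<Longrightarrow> q ^ n - inverse q ^ n \<noteq> 0"
proof
  assume n: "n > 0" and "q ^ n - inverse q ^ n = 0"
  then have "q ^ n * q ^ n = 1" using q0 by (simp add: field_simps)
  then show False using q_root[of "n+n"] n by (simp add: power_add)
qed

text \<open>A zero would give \<open>q^(2n) = -1\<close>, hence \<open>q^(4n) = 1\<close>.\<close>

lemma q_sum: "n > 0 \<Longrightarrow> q ^ n + inverse q ^ n \<noteq> 0"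
proof
  assume n: "n > 0" and "q ^ n + inverse q ^ n = 0"
  then have "q ^ n * q ^ n = -1" using q0 by (simp add: field_simps eq_neg_iff_add_eq_0)
  then have "(q ^ n * q ^ n) * (q ^ n * q ^ n) = 1" by simp
  then show False using q_root[of "n+n+(n+n)"] n by (simp add: power_add)
qed

lemma q_neq: "q - inverse q \<noteq> 0" using q_diff[of 1] by simp
lemma q1PP: "1 - inverse q * inverse q \<noteq> 0" "q*q-1 \<noteq> 0"
  using q_root[of 2] q0 by (auto simp: power2_eq_square field_simps)
lemma s_1PP: "s (1 - inverse q * inverse q) = 1 - P * P" and s_1QQ: "s (q * q - 1) = Q * Q - 1"
  by (simp_all add: s_diff s_mult s_1)

lemma qscalars_inverse: "qscalars s (inverse q)"
  by unfold_locales (use q0 q_root in \<open>auto simp: power_inverse\<close>)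

text \<open>The characteristic roots are \<open>q^2\<close> and \<open>q^-2\<close>; with
  \<open>e 0 = 0\<close> each \<open>e j\<close> is a q-number times \<open>e 1\<close>, stated here
  without division.\<close>

lemma recurrence:
  assumes "e 0 = 0" and "\<And>j. j < n \<Longrightarrow> e (j+2) = (Q*Q+P*P) * e (j+1) - e j"
  shows "j \<le> n + 1 \<Longrightarrow> (Q*Q-P*P) * e j = (s (q^(2*j)) - s (inverse q^(2*j))) * e 1"
proof (induct j rule: induct_nat_012)
  case 0 then show ?case using assms by simp
next
  case 1 then show ?case by (simp add: s_mult power2_eq_square)
next
  case (ge2 j)
  have e: "e (Suc (Suc j)) = (Q*Q+P*P) * e (Suc j) - e j"
    using assms(2)[of j] ge2(3) by simp
  have "(Q*Q-P*P) * e (Suc (Suc j)) = (Q*Q+P*P) * ((Q*Q-P*P) * e (Suc j)) - (Q*Q-P*P) * e j"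
    unfolding e by (simp add: algebra_simps)
  also have "\<dots> = (Q*Q+P*P) * ((s (q^(2*Suc j)) - s (inverse q^(2*Suc j))) * e 1) - (s (q^(2*j)) - s (inverse q^(2*j))) * e 1"
    using ge2 by simp
  also have "\<dots> = (s (q^(2*Suc (Suc j))) - s (inverse q^(2*Suc (Suc j)))) * e 1"
    by (simp add: algebra_simps s_mult)
  finally show ?case .
qed

end

section \<open>Root vectors\<close>

locale serre = qscalars s q for s :: "'f::field \<Rightarrow> 'a::ring_1" and q +
  fixes A B :: 'a
  assumes serre_A: "A * (P * (A * (Q*A*B - P*B*A)) - Q * ((Q*A*B - P*B*A) * A))
      = (P * (A * (Q*A*B - P*B*A)) - Q * ((Q*A*B - P*B*A) * A)) * A"
    and serre_B: "B * (P * (B * (Q*B*A - P*A*B)) - Q * ((Q*B*A - P*A*B) * B))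
      = (P * (B * (Q*B*A - P*A*B)) - Q * ((Q*B*A - P*A*B) * B)) * B"
begin

text \<open>Up to scalars, \<open>x n\<close>, \<open>y n\<close> and \<open>f n\<close> are Damiani's root vectors of weights \<open>n\<delta> + \<alpha>\<^sub>1\<close>,
  \<open>n\<delta> + \<alpha>\<^sub>0\<close> and \<open>n\<delta>\<close>; the value of \<open>f 0\<close> makes \<open>bracket_x\<close> below true for \<open>k = 0\<close>.\<close>

definition "lam = (q*q - inverse q * inverse q) * (q - inverse q)"

lemma lam0: "lam \<noteq> 0" using q_diff[of 1] q_diff[of 2] by (simp add: lam_def power2_eq_square)
lemma s_lam: "s lam = (Q*Q - P*P) * (Q - P)" by (simp add: lam_def s_mult s_diff)

definition "f1 = B*A - Q*Q*A*B"

primrec x where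
  "x 0 = B"
| "x (Suc n) = s (inverse lam) * (f1 * x n - x n * f1)"

primrec y where
  "y 0 = A"
| "y (Suc n) = s (inverse lam) * (y n * f1 - f1 * y n)"

lemma f1_x: "f1 * x n - x n * f1 = s lam * x (Suc n)"
  using lam0 by (simp add: s_1 flip: mult.assoc s_mult)
lemma f1_y: "f1 * y n - y n * f1 = s (- lam) * y (Suc n)"
  using lam0 by (simp add: s_1 s_minus flip: mult.assoc s_mult)

declare x.simps(2)[simp del] y.simps(2)[simp del]

text \<open>Left and right multiplication by \<open>B\<close> commute, so the plain bracket and the
  two q-brackets in the Serre relation may be taken in any order. Starting with the
  \<open>inverse q\<close>-bracket produces \<open>f1\<close> up to a scalar.\<close>

lemma f1_serre_B: "((B*A - Q*Q*A*B)*x 0 - x 0*(B*A - Q*Q*A*B)) * x 0 - Q*Q*x 0*((B*A - Q*Q*A*B)*x 0 - x 0*(B*A - Q*Q*A*B)) = 0"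
proof -
  let ?C = "Q*B*A - P*A*B" let ?D = "P*(B*?C) - Q*(?C*B)"
  have "((B*A - Q*Q*A*B)*B - B*(B*A - Q*Q*A*B)) * B - Q*Q*B*((B*A - Q*Q*A*B)*B - B*(B*A - Q*Q*A*B)) = Q*Q*(B*?D-?D*B)"
    by (simp add: algebra_simps)
  then show ?thesis using serre_B by simp
qed

lemma f1_serre_A: "y 0 * ((B*A - Q*Q*A*B)*y 0 - y 0*(B*A - Q*Q*A*B)) - Q*Q*((B*A - Q*Q*A*B)*y 0 - y 0*(B*A - Q*Q*A*B)) * y 0 = 0"
proof -
  let ?C = "Q*A*B - P*B*A" let ?D = "P*(A*?C) - Q*(?C*A)"
  have "A*((B*A - Q*Q*A*B)*A - A*(B*A - Q*Q*A*B)) - Q*Q*((B*A - Q*Q*A*B)*A - A*(B*A - Q*Q*A*B))*A = Q*Q*(A*?D-?D*A)"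
    by (simp add: algebra_simps)
  then show ?thesis using serre_A by simp
qed

lemma x_serre: "x 1 * x 0 = Q*Q*x 0*x 1"
proof -
  have "s lam * x 1 * x 0 - Q*Q*x 0*(s lam * x 1) = 0"
    unfolding One_nat_def f1_x[symmetric] f1_def by (rule f1_serre_B)
  moreover have "s lam * x 1 * x 0 - Q*Q*x 0*(s lam * x 1) = s lam * (x 1 * x 0 - Q*Q*x 0*x 1)"
    by (simp add: s_lam algebra_simps)
  ultimately have "s lam * (x 1 * x 0 - Q*Q*x 0*x 1) = 0" by simp
  then show ?thesis by (rule s_cancel_eq[OF lam0])
qed

lemma y_serre: "y 0 * y 1 = Q*Q*y 1*y 0"
proof -
  have "y 0 * (s (-lam) * y 1) - Q*Q*(s (-lam) * y 1)*y 0 = 0"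
    unfolding One_nat_def f1_y[symmetric] f1_def by (rule f1_serre_A)
  moreover have "y 0 * (s (-lam) * y 1) - Q*Q*(s (-lam) * y 1)*y 0 = s (-lam) * (y 0 * y 1 - Q*Q*y 1*y 0)"
    by (simp add: s_lam s_minus algebra_simps)
  ultimately have "s (-lam) * (y 0 * y 1 - Q*Q*y 1*y 0) = 0" by simp
  from s_cancel_eq[OF _ this] show ?thesis using lam0 by simp
qed

section \<open>Simultaneous induction for the Drinfeld-type relations\<close>

definition "F i j = x i * y j - Q*Q*y j*x i"
definition "f n = (case n of 0 \<Rightarrow> Q - P | Suc k \<Rightarrow> F 0 k)"

lemma f_0: "f 0 = Q - P" and f_Suc: "f (Suc k) = F 0 k" by (simp_all add: f_def)
lemma f_1: "f (Suc 0) = f1" by (simp add: f_Suc F_def f1_def)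
lemma f_0_comm: "z * f 0 = f 0 * z" by (simp add: f_0 algebra_simps)

text \<open>Bracketing with \<open>f1\<close> is a derivation that raises \<open>i\<close> or
  \<open>j\<close>, with opposite signs. Once \<open>f1\<close> commutes with \<open>F i j\<close>,
  a step of \<open>i\<close> can be traded for a step of \<open>j\<close>.\<close>

lemma f1_F: "f1 * F i j - F i j * f1 = s lam * (F (Suc i) j - F i (Suc j))"
proof -
  have "f1 * F i j - F i j * f1 = (f1 * x i - x i * f1) * y j + x i * (f1 * y j - y j * f1)
     - Q*Q*(f1 * y j - y j * f1) * x i - Q*Q*y j*(f1 * x i - x i * f1)"
    unfolding F_def by (simp add: algebra_simps)
  also have "\<dots> = s lam * (F (Suc i) j - F i (Suc j))"
    unfolding f1_x f1_y F_def by (simp add: s_lam s_minus algebra_simps)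
  finally show ?thesis .
qed

text \<open>Both clauses bound the same weight: \<open>F i j\<close> has weight
  \<open>i + j + 1\<close> and \<open>f m * f k\<close> has weight \<open>m + k\<close>, in units of
  the imaginary root, and all weights up to \<open>n + 1\<close> are included.\<close>

definition "relations_up_to n \<longleftrightarrow> (\<forall>i j. i + j \<le> n \<longrightarrow> F i j = F 0 (i + j)) \<and> (\<forall>m k. m + k \<le> n + 1 \<longrightarrow> f m * f k = f k * f m)"

lemma F_shift: "relations_up_to n \<Longrightarrow> i + j \<le> n \<Longrightarrow> F i j = F 0 (i + j)"
  unfolding relations_up_to_def by blast
lemma f_comm: "relations_up_to n \<Longrightarrow> m + k \<le> n + 1 \<Longrightarrow> f m * f k = f k * f m"
  unfolding relations_up_to_def by blast

lemma bracket_x_0: assumes "relations_up_to n" "k \<le> n"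
  shows "f (Suc k) * x 0 - x 0 * f (Suc k) = Q*Q*f k*x 1 - P*P*x 1*f k"
proof (cases k)
  case 0
  \<comment> \<open>The value of \<open>lam\<close> is chosen so that, with
    \<open>f 0 = Q - P\<close>, this case is the definition of \<open>x 1\<close>.\<close>
  then show ?thesis unfolding f_0 0 f_1 f1_x s_lam by (simp add: algebra_simps)
next
  case (Suc l)
  have "f (Suc k) = F 1 l" using F_shift[OF assms(1), of 1 l] assms(2) Suc by (simp add: f_Suc)
  then show ?thesis using bracket_root_x[OF x_serre, of "y l"] Suc by (simp add: f_Suc F_def)
qed

lemma bracket_y_0: assumes "relations_up_to n" "k \<le> n"
  shows "f (Suc k) * y 0 - y 0 * f (Suc k) = P*P*f k*y 1 - Q*Q*y 1*f k"
proof (cases k)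
  case 0
  then show ?thesis unfolding f_0 0 f_1 f1_y s_minus s_lam by (simp add: algebra_simps)
next
  case (Suc l)
  have "F (Suc l) 0 = F 0 (Suc l)" "F l 1 = F 0 (Suc l)" "F l 0 = F 0 l"
    using F_shift[OF assms(1), of "Suc l" 0] F_shift[OF assms(1), of l 1] F_shift[OF assms(1), of l 0] assms(2) Suc by simp_all
  then have "f (Suc k) = F l 1" "f k = F l 0" using Suc by (simp_all add: f_Suc)
  then show ?thesis using bracket_root_y[OF y_serre, of "x l"] Suc by (simp add: f_Suc F_def)
qed

text \<open>Bracketing with \<open>f1\<close> raises \<open>i\<close>, starting from
  \<open>bracket_x_0\<close>. It requires \<open>f1\<close> to commute with
  \<open>f (Suc k)\<close>, so the bound on \<open>k\<close> is one smaller than there.\<close>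

lemma bracket_x: assumes "relations_up_to n" "Suc k \<le> n"
  shows "f (Suc k) * x i - x i * f (Suc k) = Q*Q*f k*x (Suc i) - P*P*x (Suc i)*f k"
proof (induct i)
  case 0 show ?case using bracket_x_0[OF assms(1), of k] assms(2) by simp
next
  case (Suc i)
  have "f1 * f (Suc k) = f (Suc k) * f1" "f1 * f k = f k * f1"
    using f_comm[OF assms(1), of 1 "Suc k"] f_comm[OF assms(1), of 1 k] assms(2) by (simp_all add: f_1)
  from bracket_shift[OF s_comm this Suc f1_x f1_x]
  show ?case by (rule s_cancel_eq[OF lam0])
qed

text \<open>The relations for \<open>y\<close> are those for \<open>x\<close> with \<open>q\<close>
  inverted.\<close>

interpretation Pc: central_unit P Q
  by unfold_locales (rule s_comm, rule s_comm, simp)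

lemma bracket_y: assumes "relations_up_to n" "Suc k \<le> n"
  shows "f (Suc k) * y i - y i * f (Suc k) = P*P*f k*y (Suc i) - Q*Q*y (Suc i)*f k"
proof (induct i)
  case 0 show ?case using bracket_y_0[OF assms(1), of k] assms(2) by simp
next
  case (Suc i)
  have "f1 * f (Suc k) = f (Suc k) * f1" "f1 * f k = f k * f1"
    using f_comm[OF assms(1), of 1 "Suc k"] f_comm[OF assms(1), of 1 k] assms(2) by (simp_all add: f_1)
  from Pc.bracket_shift[OF s_comm this Suc f1_y f1_y]
  show ?case using s_cancel_eq[of "-lam"] lam0 by simp
qed

lemma commutator_recurrence: assumes "relations_up_to n" "j < n"
  shows "f (j+2) * f (n-j) - f (n-j) * f (j+2) = (Q*Q+P*P) * (f (j+1) * f (n-j+1) - f (n-j+1) * f (j+1))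
    - (f j * f (n-j+2) - f (n-j+2) * f j)"
proof -
  define l where "l = n - j - 1"
  have l: "n - j = Suc l" "n = Suc (l + j)" using assms by (auto simp: l_def)
  note F = F_shift[OF assms(1)]
  \<comment> \<open>For \<open>l = 0\<close> the index \<open>j + 2\<close> equals
    \<open>n + 1\<close>, out of reach of \<open>bracket_y\<close> but not of
    \<open>bracket_y_0\<close>.\<close>
  have y: "f (Suc (Suc j)) * y l - y l * f (Suc (Suc j)) = P*P*f (Suc j)*y (Suc l) - Q*Q*y (Suc l)*f (Suc j)"
    using bracket_y[OF assms(1), of "Suc j" l] bracket_y_0[OF assms(1), of "Suc j"] l assms by (cases l) auto
  have F1: "x 1 * y l - Q*Q*y l*x 1 = F 0 (Suc l)" "x 0 * y (Suc l) - Q*Q*y (Suc l)*x 0 = F 0 (Suc l)"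
    using F[of 1 l] l by (auto simp: F_def)
  \<comment> \<open>For \<open>j = 0\<close> the element \<open>F 1 (Suc l)\<close> lies beyond the
    hypothesis on \<open>n\<close>, but \<open>f 0\<close> is a scalar and both commutators
    vanish.\<close>
  have e: "f j * F 1 (Suc l) - F 1 (Suc l) * f j = f j * F 0 (Suc (Suc l)) - F 0 (Suc (Suc l)) * f j"
  proof (cases j)
    case 0 then show ?thesis using f_0_comm by simp
  next
    case (Suc i) then show ?thesis using F[of 1 "Suc l"] l by simp
  qed
  have "f (Suc (Suc j)) * x 0 - x 0 * f (Suc (Suc j)) = Q*Q*f (Suc j)*x 1 - P*P*x 1*f (Suc j)"
    "f (Suc j) * x 0 - x 0 * f (Suc j) = Q*Q*f j*x 1 - P*P*x 1*f j"
    "f (Suc j) * y l - y l * f (Suc j) = P*P*f j*y (Suc l) - Q*Q*y (Suc l)*f j"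
    using bracket_x_0[OF assms(1)] bracket_y[OF assms(1)] l by auto
  from bracket_imaginary[OF this(1) y this(2,3) F1]
  show ?thesis using e unfolding F_def[symmetric] l(1) by (simp add: f_Suc)
qed

lemma relations_up_to_0: "relations_up_to 0"
proof -
  have "f m * f k = f k * f m" if "m + k \<le> 1" for m k
  proof (cases "m = 0 \<or> k = 0")
    case True then show ?thesis using f_0_comm by metis
  next
    case False then show ?thesis using that by simp
  qed
  then show ?thesis by (simp add: relations_up_to_def)
qed

lemma relations_up_to_Suc: assumes "relations_up_to n" shows "relations_up_to (Suc n)"
proof -
  define e where "e j = f j * f (n+2-j) - f (n+2-j) * f j" for j
  have e0: "e 0 = 0" using f_0_comm by (simp add: e_def)
  have "e (j+2) = (Q*Q+P*P) * e (j+1) - e j" if "j < n" for j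
    using commutator_recurrence[OF assms that] that by (simp add: e_def Suc_diff_le)
  then have rec: "(Q*Q-P*P) * e j = (s (q^(2*j)) - s (inverse q^(2*j))) * e 1" if "j \<le> n + 1" for j
    using that by (rule recurrence[of e n, OF e0])
  \<comment> \<open>\<open>e (n + 1) = - e 1\<close> by antisymmetry; compared with the explicit solution of the recurrence this kills \<open>e 1\<close>.\<close>
  have e1: "e 1 = 0"
  proof (cases n)
    \<comment> \<open>Split off because \<open>q^n + inverse q^n\<close> is 2 here, possibly zero;
      \<open>e 1\<close> is the commutator of \<open>f 1\<close> with itself.\<close>
    case 0 then show ?thesis by (simp add: e_def)
  next
    case (Suc m)
    have "e (n+1) = - e 1" by (simp add: e_def)
    with rec[of "n+1"] have "(s (q^(2*(n+1))) - s (inverse q^(2*(n+1))) + (Q*Q-P*P)) * e 1 = 0"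
      by (simp add: algebra_simps)
    moreover have "q^(2*(n+1)) - inverse q^(2*(n+1)) + (q*q - inverse q*inverse q) = (q^(n+2) - inverse q^(n+2)) * (q^n + inverse q^n)"
      using q0 by (simp add: field_simps power_add power_mult power2_eq_square)
    ultimately have "s ((q^(n+2) - inverse q^(n+2)) * (q^n + inverse q^n)) * e 1 = 0"
      by (metis s_add s_diff s_mult)
    moreover have "(q^(n+2) - inverse q^(n+2)) * (q^n + inverse q^n) \<noteq> 0"
      by (intro no_zero_divisors q_diff q_sum) (simp_all add: Suc)
    ultimately show ?thesis using s_cancel by blast
  qed
  have "s (q*q-inverse q*inverse q) * e j = 0" if "j \<le> n+1" for j
    using rec[OF that] e1 by (simp add: s_diff s_mult)
  then have "e j = 0" if "j \<le> n+1" for j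
    using s_cancel[of "q*q-inverse q*inverse q"] q_diff[of 2] that by (simp add: power2_eq_square)
  moreover have "e (n+2) = 0" using f_0_comm by (simp add: e_def)
  ultimately have ej: "e j = 0" if "j \<le> n+2" for j
    using that by (metis add_Suc_right le_Suc_eq one_add_one plus_1_eq_Suc)
  have c: "f m * f k = f k * f m" if "m + k \<le> n + 2" for m k
  proof (cases "m + k = n+2")
    case True
    then have "n + 2 - m = k" by simp
    then show ?thesis using ej[of m] True by (simp add: e_def)
  next
    case False then show ?thesis using f_comm[OF assms, of m k] that by simp
  qed
  \<comment> \<open>By the new commutators \<open>f1\<close> commutes with \<open>f (Suc n)\<close>,
    so \<open>f1_F\<close> lowers \<open>i\<close> one step at a time.\<close>
  have eq: "F i j = F 0 (i+j)" if "i + j = Suc n" for i j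
    using that
  proof (induct i arbitrary: j)
    case (Suc i)
    have "F i j = f (Suc n)" using F_shift[OF assms, of i j] Suc(2) by (simp add: f_Suc)
    then have "f1 * F i j = F i j * f1" using c[of 1 "Suc n"] by (simp add: f_1)
    with f1_F[of i j] have "s lam * (F (Suc i) j - F i (Suc j)) = 0" by simp
    then have "F (Suc i) j = F i (Suc j)" by (rule s_cancel_eq[OF lam0])
    then show ?case using Suc by simp
  qed simp
  have "F i j = F 0 (i+j)" if "i + j \<le> Suc n" for i j
  proof (cases "i + j = Suc n")
    case True then show ?thesis by (rule eq)
  next
    case False then show ?thesis using that by (intro F_shift[OF assms]) simp
  qed
  moreover have "m + k \<le> Suc n + 1 \<Longrightarrow> f m * f k = f k * f m" for m k
    using c[of m k] by simp
  ultimately show ?thesis unfolding relations_up_to_def by blast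
qed

lemma relations_up_to: "relations_up_to n" by (induct n) (simp_all add: relations_up_to_0 relations_up_to_Suc)

lemma F_eq: "F i j = f (Suc (i + j))"
  using F_shift[OF relations_up_to[of "i + j"], of i j] by (simp add: f_Suc)
lemma f_commute: "f m * f k = f k * f m"
  using f_comm[OF relations_up_to[of "m + k"], of m k] by simp
lemma bracket_f_x: "f (Suc k) * x i - x i * f (Suc k) = Q*Q*f k*x (Suc i) - P*P*x (Suc i)*f k"
  using bracket_x[OF relations_up_to[of "Suc k"], of k] by simp
lemma bracket_f_y: "f (Suc k) * y i - y i * f (Suc k) = P*P*f k*y (Suc i) - Q*Q*y (Suc i)*f k"
  using bracket_y[OF relations_up_to[of "Suc k"], of k] by simp

end

section \<open>Half currents\<close>

text \<open>In use, \<open>t\<close> and \<open>u\<close> are the variables of two-variable series,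
  or both are \<open>fps_X\<close>, or \<open>u\<close> is a power of \<open>q\<close> in a
  coefficientwise argument.\<close>

locale central_unit2 = central_unit Q P for Q P :: "'a::ring_1" +
  fixes t u :: 'a
  assumes t_comm: "z * t = t * z" and u_comm: "z * u = u * z"
begin

lemma cent2 [simp]:
  "NO_MATCH Q y \<Longrightarrow> NO_MATCH P y \<Longrightarrow> NO_MATCH t y \<Longrightarrow> y * t = t * y"
  "NO_MATCH Q y \<Longrightarrow> NO_MATCH P y \<Longrightarrow> NO_MATCH t y \<Longrightarrow> y * (t * z) = t * (y * z)"
  "NO_MATCH Q y \<Longrightarrow> NO_MATCH P y \<Longrightarrow> NO_MATCH t y \<Longrightarrow> NO_MATCH u y \<Longrightarrow> y * u = u * y"
  "NO_MATCH Q y \<Longrightarrow> NO_MATCH P y \<Longrightarrow> NO_MATCH t y \<Longrightarrow> NO_MATCH u y \<Longrightarrow> y * (u * z) = u * (y * z)"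
  using t_comm u_comm by (metis mult.assoc)+

text \<open>With \<open>b = a(qz)\<close> and \<open>d = a(q^-1 z)\<close> the parentheses are
  dilated defects of the relation wanted for \<open>a\<close>; together they form, up to sign, the
  defect of the relation for \<open>b * d\<close>.\<close>

lemma dilation_identity:
  assumes "\<psi> = b * d" "x * \<psi> - \<psi> * x = t * (Q*Q*x1*\<psi> - P*P*\<psi>*x1)"
  shows "b * (d * x - x * d - P*t*(P*d*x1 - Q*x1*d)) + (b * x - x * b - Q*t*(P*b*x1 - Q*x1*b)) * d = 0"
proof -
  have "b * (d * x - x * d - P*t*(P*d*x1 - Q*x1*d)) + (b * x - x * b - Q*t*(P*b*x1 - Q*x1*b)) * d
    = t * (Q*Q*x1*(b*d) - P*P*(b*d)*x1) - (x * (b*d) - (b*d) * x)"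
    by (simp add: algebra_simps)
  then show ?thesis using assms by simp
qed

lemma inverse_identity:
  assumes "\<psi> * p = 1" "p * \<psi> = 1" "p * x - x * p = t * (Q*Q*p*x1 - P*P*x1*p)"
  shows "x * \<psi> - \<psi> * x = t * (Q*Q*x1*\<psi> - P*P*\<psi>*x1)"
proof -
  have "x * \<psi> - \<psi> * x = \<psi> * (p * x - x * p) * \<psi>"
    using assms(1,2) by (simp add: algebra_simps flip: mult.assoc) (simp add: mult.assoc)
  also have "\<dots> = t * (Q*Q*(\<psi>*p)*x1*\<psi> - P*P*\<psi>*x1*(p*\<psi>))"
    unfolding assms(3) by (simp add: algebra_simps)
  finally show ?thesis using assms by simp
qed

text \<open>Here \<open>a\<close>, \<open>b\<close>, \<open>w\<close>, \<open>wt\<close>,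
  \<open>Y\<close> stand for \<open>a(u)\<close>, \<open>a(t)\<close>, \<open>W(u)\<close>,
  \<open>W(t)\<close>, \<open>X(qt)\<close>. Moving \<open>a(u)\<close> past
  \<open>W(t) = a(t)X(qt)\<close> leaves terms in \<open>x\<close>, which combine to
  \<open>w\<close>. The primed version uses \<open>W(t) = X(q^-1 t)a(t)\<close>.\<close>

lemma exchange_current:
  assumes ex: "a * (t*Y - P*P*u*(Y - x)) = (t*Y - u*(Y - x)) * a"
    and w: "(Q-P)*w = Q*x*a - P*a*x" and wt: "wt = b * Y" and ab: "a * b = b * a"
  shows "(Q-P)*((t - P*P*u)*a*wt - (t-u)*wt*a - (1-P*P)*u*b*w) = 0"
proof -
  have "(Q-P)*((t - P*P*u)*a*wt - (t-u)*wt*a - (1-P*P)*u*b*w) = 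
   (Q-P)*(b*(a * (t*Y - P*P*u*(Y - x)) - (t*Y - u*(Y - x)) * a)) + (1-P*P)*u*b*((Q*x*a - P*a*x) - (Q-P)*w)
   + (Q-P)*(t-P*P*u)*(a*b-b*a)*Y"
    unfolding wt by (simp add: algebra_simps)
  then show ?thesis using assms by simp
qed

lemma exchange_current':
  assumes ex: "a * (t*Y - u*(Y - x)) = (t*Y - Q*Q*u*(Y - x)) * a"
    and w: "(Q-P)*w = Q*x*a - P*a*x" and wt: "wt = Y * b" and ab: "a * b = b * a"
  shows "(Q-P)*((t - u)*a*wt - (t-Q*Q*u)*wt*a - (Q*Q-1)*u*w*b) = 0"
proof -
  have "(Q-P)*((t - u)*a*wt - (t-Q*Q*u)*wt*a - (Q*Q-1)*u*w*b) = 
   (Q-P)*((a * (t*Y - u*(Y - x)) - (t*Y - Q*Q*u*(Y - x)) * a)*b) + (Q*Q-1)*u*((Q*x*a - P*a*x) - (Q-P)*w)*b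
   + (Q-P)*(t-Q*Q*u)*Y*(a*b-b*a)"
    unfolding wt by (simp add: algebra_simps)
  then show ?thesis using assms by simp
qed

text \<open>Subtracting \<open>P*P\<close> times the second relation from the first turns the
  weighted products into plain commutators.\<close>

lemma exchange_symmetric:
  assumes "(t - P*P*u)*a*wt - (t-u)*wt*a = (1-P*P)*u*b*w"
    and "(t - u)*a*wt - (t-Q*Q*u)*wt*a = (Q*Q-1)*u*w*b"
  shows "(1-P*P) * (t*(a*wt - wt*a) - u*(b*w - w*b)) = 0"
proof -
  have "(1-P*P) * (t*(a*wt - wt*a) - u*(b*w - w*b)) =
    ((t - P*P*u)*a*wt - (t-u)*wt*a - (1-P*P)*u*b*w)
   - P*P*((t - u)*a*wt - (t-Q*Q*u)*wt*a - (Q*Q-1)*u*w*b)"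
    by (simp add: algebra_simps)
  then show ?thesis using assms by simp
qed

end

context central_unit begin

text \<open>Read \<open>x\<^sub>ix\<^sub>j\<close> as \<open>\<sigma>\<^sup>i\<tau>\<^sup>j\<close>.  Bracketing with \<open>a\<^sub>1\<close> multiplies by \<open>\<sigma> + \<tau>\<close>, and bracketing with \<open>a\<^sub>2\<close> by
  \<open>\<sigma>\<^sup>2 + \<tau>\<^sup>2 + (1 - q\<^sup>-\<^sup>2)\<sigma>\<tau>\<close>, up to scalars and multiples of the former; hence multiplication by \<open>\<sigma>\<tau>\<close>
  preserves quadratic relations.\<close>

lemma serre_shift:
  assumes "a1*x - x*a1 = (P-Q)*x1" "a1*x1 - x1*a1 = (P-Q)*x2" "a1*x2 - x2*a1 = (P-Q)*x3"
    and "a2*x - x*a2 = P*a1*x1 - Q*x1*a1" "a2*x1 - x1*a2 = P*a1*x2 - Q*x2*a1"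
    and r: "x1*x = Q*Q*x*x1"
  shows "(P-Q)*(P-Q)*(P+Q)*(x2*x1 - Q*Q*x1*x2) = 0"
proof -
  define D where "D z = a1 * z - z * a1" for z
  define D2 where "D2 z = a2 * z - z * a2" for z
  have der: "D (y*z) = D y * z + y * D z" "D2 (y*z) = D2 y * z + y * D2 z" 
    "D (y-z) = D y - D z" "D2 (y-z) = D2 y - D2 z" "D (y+z) = D y + D z" 
    "D 0 = 0" "D2 0 = 0" "D Q = 0" "D P = 0" "D2 Q = 0" "D2 P = 0" for y z
    by (simp_all add: D_def D2_def algebra_simps)
  have x: "D x = (P-Q)*x1" "D x1 = (P-Q)*x2" "D x2 = (P-Q)*x3" using assms by (simp_all add: D_def)
  have a1: "x1 * a1 = a1*x1 - (P-Q)*x2" "x2 * a1 = a1*x2 - (P-Q)*x3" using assms by (simp_all add: algebra_simps)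
  have y: "D2 x = P*a1*x1 - Q*(a1*x1 - (P-Q)*x2)" "D2 x1 = P*a1*x2 - Q*(a1*x2 - (P-Q)*x3)"
    using assms a1 by (simp_all add: D2_def mult.assoc)
  have xa: "x * a1 = a1*x - (P-Q)*x1" using assms by (simp add: algebra_simps)
  let ?r = "x1*x - Q*Q*x*x1"
  have "D (D ?r) = 0" "D ?r = 0" "D2 ?r = 0" using r by (simp_all add: D_def D2_def)
  moreover have "(P-Q)*(P-Q)*(P+Q)*(x2*x1 - Q*Q*x1*x2) = Q*D (D ?r) - (P-Q)*(D2 ?r - a1*D ?r)"
    unfolding der x y
    by (simp add: algebra_simps der x xa a1 flip: mult.assoc[of x a1] mult.assoc[of x1 a1])
      (simp add: mult_2 distrib_left add_ac)
  ultimately show ?thesis by simp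
qed

text \<open>Two uses of the relation between \<open>a\<close> and \<open>x\<close>, with cross terms
  removed by \<open>r\<close>, lower the index on the \<open>a\<close> side by two and raise that of
  \<open>x\<close> by one. This drives the induction in \<open>x0_w\<close>.\<close>

lemma commutator_shift:
  assumes "b*x - x*b = P*a*x1 - Q*x1*a" "a*x - x*a = P*a'*x1 - Q*x1*a'" and r: "x1*x = Q*Q*x*x1"
  shows "P*(b*x - x*b)*x - Q*x*(b*x - x*b) = P*(a'*x1 - x1*a')*x1 - Q*x1*(a'*x1-x1*a')"
proof -
  have "P*(P*a*x1 - Q*x1*a)*x - Q*x*(P*a*x1 - Q*x1*a) = (a*x-x*a)*x1 - x1*(a*x-x*a)
     + P*P*a*(x1*x-Q*Q*x*x1) - (x1*x-Q*Q*x*x1)*a"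
    by (simp add: algebra_simps)
  also have "\<dots> = P*(a'*x1 - x1*a')*x1 - Q*x1*(a'*x1-x1*a')"
    unfolding assms(2) using r by (simp add: algebra_simps)
  finally show ?thesis unfolding assms(1) .
qed

end


text \<open>By iteration \<open>e i\<close> is divisible by every power of the variable.\<close>

lemma fps_X_fixpoint_zero:
  fixes e :: "nat \<Rightarrow> 'a::ring_1 fps"
  assumes "\<And>i. e i = fps_X * (b * e (Suc i))"
  shows "e i = 0"
proof -
  have "e i $ n = 0" for n
  proof (induct n arbitrary: i rule: less_induct)
    case (less n)
    have "e i $ n = (fps_X * (b * e (Suc i))) $ n" by (rule arg_cong[OF assms])
    also have "\<dots> = 0" using less by (cases n) (auto simp: fps_mult_nth intro!: sum.neutral)
    finally show ?case .
  qed
  then show ?thesis by (simp add: fps_eq_iff)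
qed

section \<open>Power series and dilations of the variable\<close>

context scalars
begin

definition sc :: "'f \<Rightarrow> 'a fps" where "sc c = fps_const (s c)"

lemma scalars_fps: "scalars sc"
proof
  show "z * sc c = sc c * z" for z c
    by (rule fps_ext) (simp add: sc_def s_comm[of _ c])
qed (simp_all add: sc_def s_add s_mult s_1)

definition dil :: "'f \<Rightarrow> 'a fps \<Rightarrow> 'a fps" where "dil c g = Abs_fps (\<lambda>n. s (c ^ n) * g $ n)"

lemma dil_nth [simp]: "dil c g $ n = s (c ^ n) * g $ n" by (simp add: dil_def)

lemma dil_mult: "dil c (g * h) = dil c g * dil c h"
proof (rule fps_ext)
  fix n
  have "s (c^i) * g$i * (s (c^(n-i)) * h$(n-i)) = s (c^n) * (g$i * h$(n-i))" if "i \<le> n" for i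
  proof -
    have "s (c^i) * g$i * (s (c^(n-i)) * h$(n-i)) = s (c^i) * s (c^(n-i)) * g$i * h$(n-i)"
      by (metis mult.assoc s_comm)
    also have "s (c^i) * s (c^(n-i)) = s (c^n)" using that by (simp flip: s_mult power_add)
    finally show ?thesis by (simp add: mult.assoc)
  qed
  then show "dil c (g * h) $ n = (dil c g * dil c h) $ n"
    by (simp add: fps_mult_nth sum_distrib_left)
qed

lemma dil_add: "dil c (g + h) = dil c g + dil c h"
  and dil_diff: "dil c (g - h) = dil c g - dil c h"
  and dil_const: "dil c (fps_const z) = fps_const z"
  and dil_sc: "dil c (sc d) = sc d"
  and dil_one: "dil c 1 = 1"
  and dil_X: "dil c fps_X = sc c * fps_X"
  and dil_1: "dil 1 g = g"
  and dil_dil: "dil c (dil d g) = dil (c * d) g"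
  by (simp_all add: fps_eq_iff distrib_left right_diff_distrib s_1 sc_def s_mult fps_X_def power_mult_distrib mult.assoc)

lemmas dil_simps = dil_add dil_diff dil_const dil_sc dil_one dil_X dil_1 dil_dil dil_mult

end

context qscalars
begin

lemma qscalars_fps: "qscalars sc q"
proof -
  interpret fs: scalars sc by (rule scalars_fps)
  show ?thesis by unfold_locales (use q0 q_root in auto)
qed

text \<open>A lowest nonzero coefficient, necessarily of degree \<open>n > 0\<close>, would be
  killed by \<open>q^n + q^-n\<close>, as \<open>b\<close> and \<open>c\<close> have constant term
  1.\<close>

lemma dilated_sum_eq_0:
  assumes "e $ 0 = 0" "b $ 0 = 1" "c $ 0 = 1" "b * dil (inverse q) e + dil q e * c = 0"
  shows "e = 0"
proof -
  have "e $ n = 0" for n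
  proof (induct n rule: less_induct)
    case (less n)
    show ?case
    proof (cases "n = 0")
      case False
      have "(b * dil (inverse q) e) $ n = (\<Sum>i\<in>{0}. b $ i * dil (inverse q) e $ (n - i))"
        unfolding fps_mult_nth by (rule sum.mono_neutral_right) (auto simp: less)
      moreover have "(dil q e * c) $ n = (\<Sum>i\<in>{n}. dil q e $ i * c $ (n - i))"
        unfolding fps_mult_nth by (rule sum.mono_neutral_right) (auto simp: less)
      ultimately have "s (inverse q ^ n) * e $ n + s (q ^ n) * e $ n = (b * dil (inverse q) e + dil q e * c) $ n"
        using assms(2,3) by (simp add: s_1)
      also have "\<dots> = 0" using assms by simp
      finally have "s (q ^ n + inverse q ^ n) * e $ n = 0"
        by (simp add: s_add algebra_simps)
      then show ?thesis using s_cancel q_sum False by blast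
    qed (simp add: assms)
  qed
  then show ?thesis by (simp add: fps_eq_iff)
qed

text \<open>The relation for \<open>p\<close> passes to its inverse \<open>a(qz)a(q^-1 z)\<close>.
  By \<open>dilation_identity\<close> the defect \<open>e\<close> of the relation for the factor
  \<open>a\<close> then solves a homogeneous dilation equation, so it is 0.\<close>

lemma half_current_relation:
  assumes \<psi>: "\<psi> * p = 1" "p * \<psi> = 1" "dil q a * dil (inverse q) a = \<psi>" "a $ 0 = 1"
    and p: "\<And>i. p * fps_const (x i) - fps_const (x i) * p =
       fps_X * (sc q * sc q * p * fps_const (x (Suc i)) - sc (inverse q) * sc (inverse q) * fps_const (x (Suc i)) * p)"
  shows "a * fps_const (x i) - fps_const (x i) * a =
       fps_X * (sc (inverse q) * a * fps_const (x (Suc i)) - sc q * fps_const (x (Suc i)) * a)"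
proof -
  interpret fs: qscalars sc q by (rule qscalars_fps)
  interpret fs: central_unit2 "sc q" "sc (inverse q)" fps_X fps_X
    by unfold_locales (simp_all add: fps_mult_fps_X_commute)
  let ?x = "fps_const (x i)" let ?x1 = "fps_const (x (Suc i))"
  define e where "e = a * ?x - ?x * a - fps_X * (sc (inverse q) * a * ?x1 - sc q * ?x1 * a)"
  have "dil (inverse q) e = dil (inverse q) a * ?x - ?x * dil (inverse q) a
      - sc (inverse q) * fps_X * (sc (inverse q) * dil (inverse q) a * ?x1 - sc q * ?x1 * dil (inverse q) a)"
    "dil q e = dil q a * ?x - ?x * dil q a - sc q * fps_X * (sc (inverse q) * dil q a * ?x1 - sc q * ?x1 * dil q a)"
    by (simp_all add: e_def dil_simps mult.assoc)
  with fs.dilation_identity[OF \<psi>(3)[symmetric] fs.inverse_identity[OF \<psi>(1,2) p]]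
  have "dil q a * dil (inverse q) e + dil q e * dil (inverse q) a = 0" by simp
  moreover have "e $ 0 = 0" using \<psi>(4) by (simp add: e_def)
  ultimately have "e = 0" using \<psi>(4) by (intro dilated_sum_eq_0[of e "dil q a" "dil (inverse q) a"]) (simp_all add: s_1)
  then show ?thesis by (simp add: e_def)
qed

end

context central_unit2 begin

lemma exchange_coeff:
  assumes "a * x - x * a = t * (P*a*x1 - Q*x1*a)"
  shows "a * (u*x - P*P*(t*(u*Q*x1))) = (u*x - t*(u*Q*x1)) * a"
    and "a * (u*x - t*(u*P*x1)) = (u*x - Q*Q*(t*(u*P*x1))) * a"
proof -
  have "a * (u*x - P*P*(t*(u*Q*x1))) - (u*x - t*(u*Q*x1)) * a = u * ((a * x - x * a) - t * (P*a*x1 - Q*x1*a))"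
    "a * (u*x - t*(u*P*x1)) - (u*x - Q*Q*(t*(u*P*x1))) * a = u * ((a * x - x * a) - t * (P*a*x1 - Q*x1*a))"
    by (simp_all add: algebra_simps)
  then show "a * (u*x - P*P*(t*(u*Q*x1))) = (u*x - t*(u*Q*x1)) * a"
    and "a * (u*x - t*(u*P*x1)) = (u*x - Q*Q*(t*(u*P*x1))) * a"
    using assms by auto
qed

end

text \<open>In \<^typ>\<open>'a fps fps\<close> write \<open>t\<close> for the outer and \<open>u\<close> for the inner variable: \<^term>\<open>fps_const g\<close> is
  \<open>g(u)\<close> and \<open>outer g\<close> is \<open>g(t)\<close>.\<close>

definition outer :: "'a::ring_1 fps \<Rightarrow> 'a fps fps" where "outer g = Abs_fps (\<lambda>n. fps_const (g $ n))"

lemma outer_nth [simp]: "outer g $ n = fps_const (g $ n)" by (simp add: outer_def)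

lemma outer_mult: "outer (g * h) = outer g * outer h"
proof -
  have "fps_const (\<Sum>i\<in>I. f i) = (\<Sum>i\<in>I. fps_const (f i))" for f :: "nat \<Rightarrow> 'a" and I
    by (induct I rule: infinite_finite_induct) (simp_all flip: fps_const_add)
  then show ?thesis by (simp add: fps_eq_iff[of "outer (g * h)"] fps_mult_nth)
qed

lemma outer_add: "outer (g + h) = outer g + outer h"
  and outer_diff: "outer (g - h) = outer g - outer h"
  and outer_X: "outer fps_X = fps_X"
  by (simp_all add: fps_eq_iff[of "outer _"] fps_X_def)

text \<open>The sequence \<open>y\<close> satisfies the same relations as \<open>x\<close> with \<open>q\<close> replaced by its inverse, so this
  locale serves for both.\<close>

locale half_current = qscalars s q for s :: "'f::field \<Rightarrow> 'a::ring_1" and q +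
  fixes x :: "nat \<Rightarrow> 'a" and a :: "'a fps"
  assumes a_0: "a $ 0 = 1" and a_comm: "a $ m * a $ n = a $ n * a $ m"
    and rel: "a * fps_const (x i) - fps_const (x i) * a =
       fps_X * (sc (inverse q) * a * fps_const (x (Suc i)) - sc q * fps_const (x (Suc i)) * a)"
    and x_10: "x 1 * x 0 = Q * Q * x 0 * x 1"
begin

interpretation fs: qscalars sc q by (rule qscalars_fps)
interpretation ft: qscalars fs.sc q by (rule fs.qscalars_fps)

lemma fs_unit2: "(\<And>z. z * t = t * z) \<Longrightarrow> (\<And>z. z * u = u * z) \<Longrightarrow> central_unit2 (sc q) (sc (inverse q)) t u"
  by unfold_locales

interpretation fx: central_unit2 "sc q" "sc (inverse q)" fps_X fps_X
  by (rule fs_unit2) (simp_all add: fps_mult_fps_X_commute)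

interpretation tt: central_unit2 "fs.sc q" "fs.sc (inverse q)" "fps_X :: 'a fps fps" "fps_const fps_X"
proof
  show "z * fps_X = fps_X * z" for z :: "'a fps fps" by (rule fps_mult_fps_X_commute[symmetric])
  show "z * fps_const fps_X = fps_const fps_X * z" for z :: "'a fps fps"
    by (rule fps_ext) (simp add: fps_mult_fps_X_commute[symmetric])
qed

lemma rel_nth: "a $ Suc k * x i - x i * a $ Suc k = P * a $ k * x (Suc i) - Q * x (Suc i) * a $ k"
  using arg_cong[OF rel[of i], of "\<lambda>g. g $ Suc k"] by (simp add: sc_def mult.assoc)

text \<open>This solves the relation between \<open>W_1\<close>, the tilde elements and
  \<open>W_{n+1}\<close> for the latter. For the sequence \<open>y\<close> with \<open>q\<close>
  inverted, the same formula gives \<open>W_{-n}\<close>.\<close>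

definition "w n = s (inverse (q - inverse q)) * (Q * x 0 * a $ n - P * a $ n * x 0)"

lemma w_def': "(Q - P) * w n = Q * x 0 * a $ n - P * a $ n * x 0"
  using s_inverse_cancel[OF q_neq] unfolding s_diff w_def .

lemma w_fps: "(sc q - sc (inverse q)) * Abs_fps w = sc q * fps_const (x 0) * a - sc (inverse q) * a * fps_const (x 0)"
  by (rule fps_ext) (simp add: sc_def w_def' mult.assoc)

lemma sc_cancel: "(sc q - sc (inverse q)) * (g - h) = 0 \<Longrightarrow> g = h"
  using fs.s_cancel_eq[OF q_neq] unfolding fs.s_diff .

definition "Xf = Abs_fps x"
definition "W = Abs_fps w"
lemma Xf_nth [simp]: "Xf $ n = x n" and W_nth [simp]: "W $ n = w n" by (simp_all add: Xf_def W_def)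

lemma shift_dil: "dil c (Abs_fps (\<lambda>j. x (i + j))) = fps_const (x i) + fps_X * (sc c * dil c (Abs_fps (\<lambda>j. x (Suc i + j))))"
proof (rule fps_ext)
  fix n show "dil c (Abs_fps (\<lambda>j. x (i + j))) $ n = (fps_const (x i) + fps_X * (sc c * dil c (Abs_fps (\<lambda>j. x (Suc i + j))))) $ n"
    by (cases n) (simp_all add: sc_def s_1 s_mult mult.assoc)
qed

text \<open>The statement is proved for all tails \<open>Z i\<close> of the current at once:
  \<open>rel\<close> makes the defect \<open>e i\<close> equal to \<open>qz\<close> times
  \<open>e (Suc i)\<close>, which forces it to vanish.\<close>

lemma W_left: "W = a * dil q Xf"
proof -
  define Z where "Z i = dil q (Abs_fps (\<lambda>j. x (i + j)))" for i
  define e where "e i = sc q * fps_const (x i) * a - sc (inverse q) * a * fps_const (x i) - (sc q - sc (inverse q)) * a * Z i" for i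
  have Z: "Z i = fps_const (x i) + fps_X * (sc q * Z (Suc i))" for i
    unfolding Z_def by (rule shift_dil)
  have "e i = fps_X * (sc q * e (Suc i))" for i
  proof -
    have "e i - fps_X * (sc q * e (Suc i)) = sc q * (fps_X * (sc (inverse q) * a * fps_const (x (Suc i)) - sc q * fps_const (x (Suc i)) * a)
       - (a * fps_const (x i) - fps_const (x i) * a))"
      unfolding e_def by (subst Z) (simp add: algebra_simps)
    then show ?thesis using rel[of i] by simp
  qed
  from fps_X_fixpoint_zero[of e "sc q" 0, OF this] have "(sc q - sc (inverse q)) * (W - a * Z 0) = 0"
    by (simp add: e_def w_fps W_def right_diff_distrib mult.assoc)
  then have "W = a * Z 0" by (rule sc_cancel)
  then show ?thesis by (simp add: Z_def Xf_def)
qed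

lemma W_right: "W = dil (inverse q) Xf * a"
proof -
  define Z where "Z i = dil (inverse q) (Abs_fps (\<lambda>j. x (i + j)))" for i
  define e where "e i = sc q * fps_const (x i) * a - sc (inverse q) * a * fps_const (x i) - (sc q - sc (inverse q)) * Z i * a" for i
  have Z: "Z i = fps_const (x i) + fps_X * (sc (inverse q) * Z (Suc i))" for i
    unfolding Z_def by (rule shift_dil)
  have "e i = fps_X * (sc (inverse q) * e (Suc i))" for i
  proof -
    have "e i - fps_X * (sc (inverse q) * e (Suc i)) = sc (inverse q) * (fps_X * (sc (inverse q) * a * fps_const (x (Suc i)) - sc q * fps_const (x (Suc i)) * a)
       - (a * fps_const (x i) - fps_const (x i) * a))"
      unfolding e_def by (subst Z) (simp add: algebra_simps)
    then show ?thesis using rel[of i] by simp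
  qed
  from fps_X_fixpoint_zero[of e "sc (inverse q)" 0, OF this] have "(sc q - sc (inverse q)) * (W - Z 0 * a) = 0"
    by (simp add: e_def w_fps W_def right_diff_distrib mult.assoc)
  then have "W = Z 0 * a" by (rule sc_cancel)
  then show ?thesis by (simp add: Z_def Xf_def)
qed

section \<open>Exchange relations in two variables and commutativity of \<open>w\<close>\<close>

abbreviation "x0 \<equiv> fps_const (fps_const (x 0))"
abbreviation "qq \<equiv> fs.sc q"
abbreviation "pp \<equiv> fs.sc (inverse q)"
abbreviation "u \<equiv> fps_const fps_X"

lemma a_comm_fps: "fps_const a * outer a = outer a * fps_const a"
  by (rule fps_ext, simp, rule fps_ext) (simp add: a_comm)

text \<open>The coefficient of \<open>t^(m + 1)\<close> is \<open>rel\<close> at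
  \<open>i = m\<close>, multiplied by \<open>q^m\<close> in the first identity and
  \<open>q^-m\<close> in the second.\<close>

lemma exchange_outer:
  shows "fps_const a * (fps_X * outer (dil q Xf) - pp*pp*u*(outer (dil q Xf) - x0))
      = (fps_X * outer (dil q Xf) - u*(outer (dil q Xf) - x0)) * fps_const a" (is "?bracket_root_x = ?R1")
    and "fps_const a * (fps_X * outer (dil (inverse q) Xf) - u*(outer (dil (inverse q) Xf) - x0))
      = (fps_X * outer (dil (inverse q) Xf) - qq*qq*u*(outer (dil (inverse q) Xf) - x0)) * fps_const a" (is "?bracket_imaginary = ?R2")
proof -
  have Y: "outer (dil c Xf) $ m = sc (c^m) * fps_const (x m)"
    "(outer (dil c Xf) - x0) $ Suc m = sc (c^m) * sc c * fps_const (x (Suc m))" for c m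
    by (simp_all add: sc_def mult.commute[of c] flip: s_mult)
  have L: "(fps_const a * (fps_X * Y - fps_const p * u * Z)) $ Suc m = a * (Y $ m - p * (fps_X * Z $ Suc m))"
    "(fps_const a * (fps_X * Y - u * Z)) $ Suc m = a * (Y $ m - fps_X * Z $ Suc m)"
    "((fps_X * Y - fps_const p * u * Z) * fps_const a) $ Suc m = (Y $ m - p * (fps_X * Z $ Suc m)) * a"
    "((fps_X * Y - u * Z) * fps_const a) $ Suc m = (Y $ m - fps_X * Z $ Suc m) * a" for Y Z :: "'a fps fps" and p m
    by (simp_all add: mult.assoc)
  have PP: "pp * pp = fps_const (sc (inverse q) * sc (inverse q))" "qq * qq = fps_const (sc q * sc q)"
    by (simp_all add: fs.sc_def)
  have 0: "?bracket_root_x $ 0 = ?R1 $ 0" "?bracket_imaginary $ 0 = ?R2 $ 0" by (simp_all add: fs.sc_def s_1)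
  have 1: "?bracket_root_x $ Suc m = ?R1 $ Suc m" for m
  proof -
    interpret fm: central_unit2 "sc q" "sc (inverse q)" fps_X "sc (q^m)"
      by (rule fs_unit2, rule fps_mult_fps_X_commute[symmetric], rule fs.s_comm)
    show ?thesis unfolding PP L Y using fm.exchange_coeff(1)[OF rel[of m]] by (simp only: mult.assoc)
  qed
  have 2: "?bracket_imaginary $ Suc m = ?R2 $ Suc m" for m
  proof -
    interpret fm: central_unit2 "sc q" "sc (inverse q)" fps_X "sc (inverse q^m)"
      by (rule fs_unit2, rule fps_mult_fps_X_commute[symmetric], rule fs.s_comm)
    show ?thesis unfolding PP L Y using fm.exchange_coeff(2)[OF rel[of m]] by (simp only: mult.assoc)
  qed
  show "?bracket_root_x = ?R1" by (rule fps_ext) (metis 0(1) 1 not0_implies_Suc)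
  show "?bracket_imaginary = ?R2" by (rule fps_ext) (metis 0(2) 2 not0_implies_Suc)
qed

lemma w_fps2: "(qq - pp) * fps_const W = qq * x0 * fps_const a - pp * fps_const a * x0"
  using arg_cong[OF w_fps, of fps_const] unfolding W_def by (simp add: fs.sc_def flip: fps_const_mult fps_const_sub)

lemma ft_cancel: "(qq - pp) * (g - h) = 0 \<Longrightarrow> g = h"
  using ft.s_cancel_eq[OF q_neq] unfolding ft.s_diff .

lemma exchange_W:
  "(fps_X - pp*pp*u) * fps_const a * outer W - (fps_X - u) * outer W * fps_const a = (1-pp*pp)*u*outer a*fps_const W"
  "(fps_X - u) * fps_const a * outer W - (fps_X - qq*qq*u) * outer W * fps_const a = (qq*qq-1)*u*fps_const W*outer a"
proof -
  have l: "outer W = outer a * outer (dil q Xf)" and r: "outer W = outer (dil (inverse q) Xf) * outer a"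
    by (simp_all flip: outer_mult add: W_left[symmetric] W_right[symmetric])
  show "(fps_X - pp*pp*u) * fps_const a * outer W - (fps_X - u) * outer W * fps_const a = (1-pp*pp)*u*outer a*fps_const W"
    by (rule ft_cancel, rule tt.exchange_current[OF exchange_outer(1) w_fps2 l a_comm_fps])
  show "(fps_X - u) * fps_const a * outer W - (fps_X - qq*qq*u) * outer W * fps_const a = (qq*qq-1)*u*fps_const W*outer a"
    by (rule ft_cancel, rule tt.exchange_current'[OF exchange_outer(2) w_fps2 r a_comm_fps])
qed

lemma a_w_symmetric: "a $ Suc k * w n - w n * a $ Suc k = a $ Suc n * w k - w k * a $ Suc n"
proof -
  have "fs.sc (1 - inverse q * inverse q) * (fps_X*(fps_const a * outer W - outer W * fps_const a)
    - u*(outer a * fps_const W - fps_const W * outer a)) = 0"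
    using tt.exchange_symmetric[OF exchange_W] by (simp add: ft.s_diff ft.s_mult ft.s_1)
  then have "fps_X*(fps_const a * outer W - outer W * fps_const a)
    = u*(outer a * fps_const W - fps_const W * outer a)"
    by (rule ft.s_cancel_eq[OF q1PP(1)])
  from arg_cong[OF this, of "\<lambda>g. g $ Suc n $ Suc k"] show ?thesis by simp
qed

text \<open>Brackets with \<open>a $ 1\<close> and \<open>a $ 2\<close> carry the relation from
  \<open>i\<close> to \<open>i + 1\<close> through \<open>serre_shift\<close>, whose scalar factor
  is nonzero.\<close>

lemma x_Suc_x: "x (Suc i) * x i = Q * Q * x i * x (Suc i)"
proof (induct i)
  case 0 show ?case using x_10 by simp
next
  case (Suc i)
  have 1: "a $ 1 * x i - x i * a $ 1 = (P - Q) * x (Suc i)" for i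
    using rel_nth[of 0 i] by (simp add: a_0 algebra_simps)
  have 2: "a $ 2 * x i - x i * a $ 2 = P * a $ 1 * x (Suc i) - Q * x (Suc i) * a $ 1" for i
    using rel_nth[of 1 i] by (simp add: numeral_2_eq_2)
  have "(P - Q) * (P - Q) * (P + Q) * (x (Suc (Suc i)) * x (Suc i) - Q * Q * x (Suc i) * x (Suc (Suc i))) = 0"
    by (rule serre_shift[OF 1 1 1 2 2 Suc])
  moreover have "(P - Q) * (P - Q) * (P + Q) = s ((inverse q - q) * (inverse q - q) * (inverse q + q))"
    by (simp add: s_mult s_add s_diff)
  moreover have "(inverse q - q) * (inverse q - q) * (inverse q + q) \<noteq> 0"
    using q_neq q_sum[of 1] by (intro no_zero_divisors) (auto simp: add.commute)
  ultimately show ?case using s_cancel_eq by metis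
qed

text \<open>At \<open>i = 0\<close> the expression \<open>R\<close> is the commutator of
  \<open>x 0\<close> with \<open>(Q - P) * w n\<close>. Since \<open>commutator_shift\<close> lowers
  \<open>n\<close> by two but raises \<open>i\<close>, all \<open>i\<close> are treated together;
  the base case \<open>n = 1\<close> is \<open>x_Suc_x\<close>.\<close>

lemma x0_w: "x 0 * w n = w n * x 0"
proof -
  define R where "R i n = P*(a$n*x i - x i*a$n)*x i - Q*x i*(a$n*x i - x i*a$n)" for i n
  have "R i n = 0" for i n
  proof (induct n arbitrary: i rule: induct_nat_012)
    case 0 show ?case by (simp add: R_def a_0)
  next
    case 1
    have "a $ Suc 0 * x i - x i * a $ Suc 0 = (P - Q) * x (Suc i)"
      using rel_nth[of 0 i] by (simp add: a_0 algebra_simps)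
    then show ?case unfolding R_def One_nat_def by (simp only:) (simp add: algebra_simps x_Suc_x[of i])
  next
    case (ge2 n)
    have "R i (Suc (Suc n)) = R (Suc i) n"
      unfolding R_def by (rule commutator_shift[OF rel_nth rel_nth x_Suc_x])
    then show ?case using ge2 by simp
  qed
  from this[of 0 n] have "x 0 * ((Q - P) * w n) - ((Q - P) * w n) * x 0 = 0"
    unfolding w_def' by (simp add: R_def algebra_simps)
  then have "(Q - P) * (x 0 * w n - w n * x 0) = 0" by (simp add: algebra_simps)
  then show ?thesis using s_cancel_eq[OF q_neq] by (simp add: s_diff)
qed

lemma w_0: "w 0 = x 0"
proof -
  have "w 0 = x 0" using s_inverse_cancel[OF q_neq, of "x 0"]
    by (simp add: w_def a_0 s_diff flip: left_diff_distrib) (metis mult.assoc s_comm)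
  then show ?thesis .
qed

lemma a1_w: "a $ Suc 0 * w n - w n * a $ Suc 0 = a $ Suc n * x 0 - x 0 * a $ Suc n"
  using a_w_symmetric[of 0 n] by (simp add: w_0)

lemma a1_w': "Q * (a $ Suc 0 * w n - w n * a $ Suc 0) = (Q - P) * (a $ Suc n * x 0 - w (Suc n))"
  unfolding a1_w right_diff_distrib w_def' by (simp add: algebra_simps)

text \<open>The derivation \<open>D\<close>, the bracket with \<open>a $ 1\<close>, is applied to
  the commutation of \<open>w k\<close> and \<open>w n\<close>. It sends \<open>w n\<close> to a
  multiple of \<open>a $ Suc n * x 0 - w (Suc n)\<close>; the terms in \<open>a\<close> cancel by
  \<open>a_w_symmetric\<close>, leaving the commutator of \<open>w (Suc k)\<close> and
  \<open>w n\<close>.\<close>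

lemma w_comm: "w k * w n = w n * w k"
proof (induct k arbitrary: n)
  case 0
  show ?case using x0_w by (simp add: w_0)
next
  case (Suc k)
  define D where "D z = a $ Suc 0 * z - z * a $ Suc 0" for z
  let ?v = "\<lambda>n. a $ Suc n * x 0 - w (Suc n)"
  have D: "Q * D (w n) = (Q - P) * ?v n" for n
    unfolding D_def by (rule a1_w')
  have "Q * (D (w k) * w n + w k * D (w n) - D (w n) * w k - w n * D (w k)) = 
    Q * (a $ Suc 0 * (w k * w n - w n * w k) - (w k * w n - w n * w k) * a $ Suc 0)"
    by (simp add: D_def algebra_simps)
  also have "\<dots> = 0" using Suc by simp
  finally have "(Q * D (w k)) * w n + w k * (Q * D (w n)) - (Q * D (w n)) * w k - w n * (Q * D (w k)) = 0"
    by (simp add: algebra_simps)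
  then have "(Q - P) * (?v k * w n + w k * ?v n - (?v n * w k + w n * ?v k)) = 0"
    unfolding D by (simp add: algebra_simps)
  then have "?v k * w n + w k * ?v n = ?v n * w k + w n * ?v k"
    using s_cancel_eq[OF q_neq] by (simp add: s_diff)
  moreover have "x 0 * w m = w m * x 0" "w k * w m = w m * w k" for m using x0_w Suc by auto
  ultimately have "(a $ Suc k * w n - w n * a $ Suc k) * x 0 - (a $ Suc n * w k - w k * a $ Suc n) * x 0
     = w (Suc k) * w n - w n * w (Suc k)"
    by (simp add: algebra_simps)
  then show ?case using a_w_symmetric[of k n] by simp
qed

end

section \<open>The generating function of the elements \<open>G\<close>\<close>

context central_unit2 begin

text \<open>The product \<open>vt * Y\<close> is the part of \<open>G(t)\<close> that need not
  commute with \<open>a(u)\<close>. The exchange relations move \<open>a(u)\<close> through its two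
  factors in turn.\<close>

lemma gauss_commutator:
  assumes "a * (t*Y - P*P*u*(Y - x)) = (t*Y - u*(Y - x)) * a"
    and "(Q-P)*w = Q*x*a - P*a*x"
    and "(t-u)*a*vt - (t-P*P*u)*vt*a = (P*P-1)*u*v*b"
    and "wt = b * Y"
  shows "(t-u)*(a*(vt*Y) - (vt*Y)*a) = (1-P*P)*u*(vt*w - v*wt)"
proof -
  have "(t-u)*(a*(vt*Y) - (vt*Y)*a) - (1-P*P)*u*(vt*w - v*wt) =
    ((t-u)*a*vt - (t-P*P*u)*vt*a - (P*P-1)*u*v*b)*Y
   + vt*(a * (t*Y - P*P*u*(Y - x)) - (t*Y - u*(Y - x)) * a)
   + P*u*vt*((Q*x*a - P*a*x) - (Q-P)*w)"
    unfolding assms(4) by (simp add: algebra_simps)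
  then show ?thesis using assms by simp
qed

lemma gauss_commutator':
  assumes "a * (t*Y - u*(Y - x)) = (t*Y - Q*Q*u*(Y - x)) * a"
    and "(Q-P)*w = Q*x*a - P*a*x"
    and "(t-Q*Q*u)*a*vt - (t-u)*vt*a = (1-Q*Q)*u*b*v"
    and "wt = Y * b"
  shows "(t-u)*(a*(Y*vt) - (Y*vt)*a) = (Q*Q-1)*u*(w*vt - wt*v)"
proof -
  have "(t-u)*(a*(Y*vt) - (Y*vt)*a) - (Q*Q-1)*u*(w*vt - wt*v) =
    (a * (t*Y - u*(Y - x)) - (t*Y - Q*Q*u*(Y - x)) * a)*vt
   + Y*((t-Q*Q*u)*a*vt - (t-u)*vt*a - (1-Q*Q)*u*b*v)
   + Q*u*((Q*x*a - P*a*x) - (Q-P)*w)*vt"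
    unfolding assms(4) by (simp add: algebra_simps)
  then show ?thesis using assms by simp
qed

text \<open>In the commutator of \<open>A\<close> with \<open>a * Z\<close>, moving \<open>A\<close>
  past \<open>Z = X(qz)\<close> produces the tail \<open>S\<close> of \<open>p(qz)\<close>; what
  remains is the q-bracket of \<open>a\<close> with \<open>A\<close>, that is
  \<open>V\<close>.\<close>

lemma gauss_left:
  assumes AZ: "A*Z = P*P*(Z*A - (Q-P)*S)" and V: "(Q-P)*V = Q*a*A - P*A*a"
    and S: "Q*t*S = d - 1" and G: "(1-P*P)*(a-G) = t*(A*(a*Z) - (a*Z)*A)"
  shows "(1-P*P)*(G - (a*d + Q*Q*t*V*Z)) = 0"
proof -
  define e1 where "e1 = A*Z - P*P*(Z*A - (Q-P)*S)"
  define e2 where "e2 = (Q-P)*V - (Q*a*A - P*A*a)"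
  define e3 where "e3 = Q*t*S - (d-1)"
  define e4 where "e4 = (1-P*P)*(a-G) - t*(A*(a*Z) - (a*Z)*A)"
  have "(1-P*P)*(G - (a*d + Q*Q*t*V*Z)) = - e4 - t*Q*e2*Z - Q*Q*t*a*e1 + (1-P*P)*a*e3"
    unfolding e1_def e2_def e3_def e4_def by (simp add: algebra_simps)
  then show ?thesis using assms by (simp add: e1_def e2_def e3_def e4_def)
qed

lemma gauss_right:
  assumes AZ: "A*Z = P*P*(Z*A - (Q-P)*S)" and V: "(Q-P)*V = Q*a*A - P*A*a"
    and S: "P*t*S = d - 1" and G: "(1-P*P)*(a-G) = t*(A*(Z*a) - (Z*a)*A)"
  shows "(1-P*P)*(G - (d*a + t*Z*V)) = 0"
proof -
  define e1 where "e1 = A*Z - P*P*(Z*A - (Q-P)*S)"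
  define e2 where "e2 = (Q-P)*V - (Q*a*A - P*A*a)"
  define e3 where "e3 = P*t*S - (d-1)"
  define e4 where "e4 = (1-P*P)*(a-G) - t*(A*(Z*a) - (Z*a)*A)"
  have "(1-P*P)*(G - (d*a + t*Z*V)) = - e4 - t*e1*a - P*t*Z*e2 + (1-P*P)*e3*a"
    unfolding e1_def e2_def e3_def e4_def by (simp add: algebra_simps)
  then show ?thesis using assms by (simp add: e1_def e2_def e3_def e4_def)
qed

end

context central_unit begin

text \<open>As \<open>A\<close> commutes with \<open>v\<close>, the q-bracket of \<open>A\<close>
  with \<open>Y\<close> reduces to the commutator of \<open>B*A - Q*Q*A*B\<close> with
  \<open>v\<close>. That element is a multiple of \<open>a1\<close>, and \<open>c\<close> trades its
  bracket with \<open>v\<close> for that of \<open>a\<close> with \<open>A\<close>.\<close>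

lemma qcommutator_AG:
  assumes Y: "Y = v*B - B*v" "(1-P*P)*(a-G) = Y" and f: "B*A - Q*Q*A*B = - (Q-P)*(Q+P)*a1"
    and c: "a1*v - v*a1 = a*A - A*a" and v: "A*v = v*A"
  shows "(1-P*P)*((Q*A*G - P*G*A) - (Q*a*A - P*A*a)) = 0"
proof -
  have G: "(1-P*P)*G = (1-P*P)*a - Y" using Y(2) by (simp add: algebra_simps)
  have "(1-P*P)*((Q*A*G - P*G*A) - (Q*a*A - P*A*a)) = Q*A*((1-P*P)*G) - P*((1-P*P)*G)*A - (1-P*P)*(Q*a*A - P*A*a)"
    by (simp add: algebra_simps)
  also have "\<dots> = (1-P*P)*(Q+P)*(A*a - a*A) - (Q*A*Y - P*Y*A)"
    unfolding G by (simp add: algebra_simps)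
  also have "Q*A*Y - P*Y*A = P*((B*A - Q*Q*A*B)*v - v*(B*A-Q*Q*A*B)) + Q*(A*v-v*A)*B - P*B*(A*v-v*A)"
    unfolding Y(1) by (simp add: algebra_simps)
  also have "\<dots> = - (1-P*P)*(Q+P)*(a1*v-v*a1)"
    unfolding f using v by (simp add: algebra_simps)
  finally show ?thesis unfolding c by (simp add: algebra_simps)
qed

lemma qcommutator_GB:
  assumes Y: "Y = A*w - w*A" "(1-P*P)*(a-G) = Y" and f: "B*A - Q*Q*A*B = - (Q-P)*(Q+P)*a1"
    and c: "a1*w - w*a1 = a*B - B*a" and w: "B*w = w*B"
  shows "(1-P*P)*((Q*G*B - P*B*G) - (Q*B*a - P*a*B)) = 0"
proof -
  have G: "(1-P*P)*G = (1-P*P)*a - Y" using Y(2) by (simp add: algebra_simps)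
  have "(1-P*P)*((Q*G*B - P*B*G) - (Q*B*a - P*a*B)) = Q*((1-P*P)*G)*B - P*B*((1-P*P)*G) - (1-P*P)*(Q*B*a - P*a*B)"
    by (simp add: algebra_simps)
  also have "\<dots> = (1-P*P)*(Q+P)*(a*B - B*a) - (Q*Y*B - P*B*Y)"
    unfolding G by (simp add: algebra_simps)
  also have "Q*Y*B - P*B*Y = - P*((B*A - Q*Q*A*B)*w - w*(B*A-Q*Q*A*B)) - Q*A*(B*w-w*B) + P*(B*w-w*B)*A"
    unfolding Y(1) by (simp add: algebra_simps)
  also have "\<dots> = (1-P*P)*(Q+P)*(a1*w-w*a1)"
    unfolding f using w by (simp add: algebra_simps)
  finally show ?thesis unfolding c by (simp add: algebra_simps)
qed

lemma commutators_agree: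
  assumes "(Q-P)*w = Q*B*a - P*a*B" "(Q-P)*v = Q*a*A - P*A*a"
    and "(B*A - Q*Q*A*B)*a = a*(B*A - Q*Q*A*B)"
  shows "(Q-P)*((A*w - w*A) - (v*B - B*v)) = 0"
proof -
  have "(Q-P)*((A*w - w*A) - (v*B - B*v)) = A*((Q-P)*w) - ((Q-P)*w)*A - ((Q-P)*v)*B + B*((Q-P)*v)"
    by (simp add: algebra_simps)
  also have "\<dots> = - P*((B*A - Q*Q*A*B)*a - a*(B*A - Q*Q*A*B))"
    unfolding assms(1,2) by (simp add: algebra_simps)
  finally show ?thesis using assms(3) by simp
qed

end

lemma fps_commute:
  fixes g h :: "'a::ring_1 fps"
  assumes "\<And>m n. g $ m * h $ n = h $ n * g $ m"
  shows "g * h = h * g"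
proof (rule fps_ext)
  fix n
  have "(\<Sum>i=0..n. h $ (n - i) * g $ i) = (\<Sum>i=0..n. h $ i * g $ (n - i))"
    by (rule sum.reindex_bij_witness[of _ "\<lambda>i. n - i" "\<lambda>i. n - i"]) auto
  then show "(g * h) $ n = (h * g) $ n" by (simp add: fps_mult_nth assms)
qed

section \<open>The series \<open>p\<close> and \<open>a\<close> built from the imaginary root
  vectors\<close>

context serre begin

definition "p = Abs_fps (\<lambda>n. s (inverse (q - inverse q)) * f n)"

lemma p_nth: "(Q - P) * p $ n = f n"
  using s_inverse_cancel[OF q_neq] unfolding s_diff by (simp add: p_def)
lemma p_0: "p $ 0 = 1"
  using s_inverse_cancel'[OF q_neq, of 1] by (simp add: p_def f_0 s_diff)

lemma p_comm: "p $ m * p $ n = p $ n * p $ m"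
proof -
  have "(Q - P) * ((Q - P) * (p $ m * p $ n - p $ n * p $ m)) = ((Q - P) * p $ m) * ((Q - P) * p $ n) - ((Q - P) * p $ n) * ((Q - P) * p $ m)"
    by (simp add: algebra_simps)
  also have "\<dots> = 0" unfolding p_nth using f_commute by simp
  finally have "s (q - inverse q) * (s (q - inverse q) * (p $ m * p $ n - p $ n * p $ m)) = 0"
    by (simp add: s_diff)
  then show ?thesis using s_cancel[OF q_neq] s_cancel_eq[OF q_neq] by blast
qed

definition "\<psi> = fps_left_inverse p 1"

lemma psi_inverse: "\<psi> * p = 1" "p * \<psi> = 1"
  using fps_left_inverse[of 1 p] fps_right_inverse[of p 1] fps_left_inverse_eq_fps_right_inverse[of 1 p 1]
  by (simp_all add: \<psi>_def p_0)

lemma psi_0: "\<psi> $ 0 = 1" by (simp add: \<psi>_def)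

text \<open>Solves \<open>a(qz)a(q^-1 z)p(z) = 1\<close> degree by degree: the unknown of degree
  \<open>n\<close> enters with the invertible factor \<open>q^n + q^-n\<close>.\<close>

function gt :: "nat \<Rightarrow> 'a" where
  "gt n = (if n = 0 then 1 else s (inverse (q^n + inverse q^n)) *
     (\<psi> $ n - (\<Sum>i\<in>{1..<n}. s (q^i) * gt i * (s (inverse q^(n-i)) * gt (n-i)))))"
  by auto
termination by (relation "measure id") auto
declare gt.simps [simp del]

definition "a = Abs_fps gt"
lemma a_nth: "a $ n = gt n" by (simp add: a_def)
lemma a_0: "a $ 0 = 1" by (simp add: a_nth gt.simps)

lemma a_product: "dil q a * dil (inverse q) a = \<psi>"
proof (rule fps_ext)
  fix n
  show "(dil q a * dil (inverse q) a) $ n = \<psi> $ n"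
  proof (cases "n = 0")
    case True then show ?thesis by (simp add: a_0 psi_0 s_1)
  next
    case False
    let ?h = "\<lambda>i. s (q^i) * gt i * (s (inverse q^(n-i)) * gt (n-i))"
    have "{0..n} = insert 0 (insert n {1..<n})" using False by auto
    then have "(dil q a * dil (inverse q) a) $ n = ?h 0 + (?h n + (\<Sum>i\<in>{1..<n}. ?h i))"
      using False by (simp add: fps_mult_nth a_nth)
    also have "?h 0 = s (inverse q^n) * gt n" by (simp add: s_1 gt.simps[of 0])
    also have "?h n = s (q^n) * gt n" by (simp add: s_1 gt.simps[of 0])
    also have "s (inverse q^n) * gt n + (s (q^n) * gt n + (\<Sum>i\<in>{1..<n}. ?h i))
        = s (q^n + inverse q^n) * gt n + (\<Sum>i\<in>{1..<n}. ?h i)"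
      by (simp add: s_add algebra_simps)
    also have "s (q^n + inverse q^n) * gt n = \<psi> $ n - (\<Sum>i\<in>{1..<n}. ?h i)"
      using False s_inverse_cancel[OF q_sum[of n]] by (subst gt.simps) simp
    finally show ?thesis by simp
  qed
qed

text \<open>The centraliser of \<open>z\<close> contains the coefficients of the inverse of
  \<open>p\<close>, and the recursion for \<open>gt\<close> stays inside it.\<close>

lemma commute_a:
  assumes "\<And>n. z * p $ n = p $ n * z"
  shows "z * a $ n = a $ n * z"
proof -
  have zp: "fps_const z * p = p * fps_const z" using assms by (simp add: fps_eq_iff)
  have "\<psi> * fps_const z = \<psi> * (fps_const z * p) * \<psi>" using psi_inverse by (simp add: mult.assoc)
  also have "\<dots> = fps_const z * \<psi>" unfolding zp using psi_inverse by (simp flip: mult.assoc)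
  finally have psi: "z * \<psi> $ n = \<psi> $ n * z" for n by (simp add: fps_eq_iff)
  have "z * gt n = gt n * z"
  proof (induct n rule: less_induct)
    case (less n)
    have m: "z * (g * h) = g * h * z" if "z * g = g * z" "z * h = h * z" for g h
      using that by (metis mult.assoc)
    have "z * (s c * gt i * (s d * gt j)) = (s c * gt i * (s d * gt j)) * z" if "i < n" "j < n" for c d i j
      by (intro m s_comm less that)
    then have "z * (\<Sum>i\<in>{1..<n}. s (q^i) * gt i * (s (inverse q^(n-i)) * gt (n-i)))
        = (\<Sum>i\<in>{1..<n}. s (q^i) * gt i * (s (inverse q^(n-i)) * gt (n-i))) * z"
      unfolding sum_distrib_left sum_distrib_right by (intro sum.cong) auto
    then have "z * (\<psi> $ n - (\<Sum>i\<in>{1..<n}. s (q^i) * gt i * (s (inverse q^(n-i)) * gt (n-i)))) = 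
        (\<psi> $ n - (\<Sum>i\<in>{1..<n}. s (q^i) * gt i * (s (inverse q^(n-i)) * gt (n-i)))) * z"
      using psi by (simp add: left_diff_distrib right_diff_distrib)
    then have "z * (s c * (\<psi> $ n - (\<Sum>i\<in>{1..<n}. s (q^i) * gt i * (s (inverse q^(n-i)) * gt (n-i))))) = 
        (s c * (\<psi> $ n - (\<Sum>i\<in>{1..<n}. s (q^i) * gt i * (s (inverse q^(n-i)) * gt (n-i))))) * z" for c
      by (intro m s_comm)
    then show ?case by (subst (1 2) gt.simps) simp
  qed
  then show ?thesis by (simp add: a_nth)
qed

lemma p_a_comm: "p $ m * a $ n = a $ n * p $ m" by (rule commute_a) (rule p_comm)
lemma a_comm: "a $ m * a $ n = a $ n * a $ m" by (rule commute_a) (rule p_a_comm[symmetric])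

lemma p_rel: 
  "p * fps_const (x i) - fps_const (x i) * p =
       fps_X * (sc q * sc q * p * fps_const (x (Suc i)) - sc (inverse q) * sc (inverse q) * fps_const (x (Suc i)) * p)"
  "p * fps_const (y i) - fps_const (y i) * p =
       fps_X * (sc (inverse q) * sc (inverse q) * p * fps_const (y (Suc i)) - sc q * sc q * fps_const (y (Suc i)) * p)"
proof -
  have *: "p $ Suc k * x i - x i * p $ Suc k = Q*Q*p $ k*x (Suc i) - P*P*x (Suc i)*p $ k"
    "p $ Suc k * y i - y i * p $ Suc k = P*P*p $ k*y (Suc i) - Q*Q*y (Suc i)*p $ k" for k
  proof -
    have "(Q - P) * ((p $ Suc k * x i - x i * p $ Suc k) - (Q*Q*p $ k*x (Suc i) - P*P*x (Suc i)*p $ k)) = 0"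
      using bracket_f_x[of k i] unfolding p_nth[symmetric] by (simp add: algebra_simps)
    then show "p $ Suc k * x i - x i * p $ Suc k = Q*Q*p $ k*x (Suc i) - P*P*x (Suc i)*p $ k"
      using s_cancel_eq[OF q_neq] unfolding s_diff by blast
    have "(Q - P) * ((p $ Suc k * y i - y i * p $ Suc k) - (P*P*p $ k*y (Suc i) - Q*Q*y (Suc i)*p $ k)) = 0"
      using bracket_f_y[of k i] unfolding p_nth[symmetric] by (simp add: algebra_simps)
    then show "p $ Suc k * y i - y i * p $ Suc k = P*P*p $ k*y (Suc i) - Q*Q*y (Suc i)*p $ k"
      using s_cancel_eq[OF q_neq] unfolding s_diff by blast
  qed
  show "p * fps_const (x i) - fps_const (x i) * p =
       fps_X * (sc q * sc q * p * fps_const (x (Suc i)) - sc (inverse q) * sc (inverse q) * fps_const (x (Suc i)) * p)"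
    "p * fps_const (y i) - fps_const (y i) * p =
       fps_X * (sc (inverse q) * sc (inverse q) * p * fps_const (y (Suc i)) - sc q * sc q * fps_const (y (Suc i)) * p)"
    by (auto simp: fps_eq_iff sc_def p_0 * gr0_conv_Suc mult.assoc)
qed

lemma half_x: "half_current s q x a"
proof
  show "a * fps_const (x i) - fps_const (x i) * a =
       fps_X * (sc (inverse q) * a * fps_const (x (Suc i)) - sc q * fps_const (x (Suc i)) * a)" for i
    by (rule half_current_relation[where x = x, OF psi_inverse a_product a_0 p_rel(1)])
qed (rule a_0 a_comm x_serre)+

text \<open>Inverting \<open>q\<close> exchanges the two dilated factors of the inverse of
  \<open>p\<close>. They commute, so the same \<open>a\<close> serves for \<open>y\<close>.\<close>

lemma half_y: "half_current s (inverse q) y a"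
proof -
  interpret qi: qscalars s "inverse q" by (rule qscalars_inverse)
  have "dil (inverse q) a * dil (inverse (inverse q)) a = \<psi>"
    unfolding a_product[symmetric] inverse_inverse_eq
  proof (rule fps_commute)
    fix m n show "dil (inverse q) a $ m * dil q a $ n = dil q a $ n * dil (inverse q) a $ m"
      using a_comm[of m n] by (simp add: mult.assoc) (metis mult.assoc s_comm)
  qed
  note hr = qi.half_current_relation[OF psi_inverse this a_0]
  show ?thesis
  proof
    show "a * fps_const (y i) - fps_const (y i) * a =
       fps_X * (sc (inverse (inverse q)) * a * fps_const (y (Suc i)) - sc (inverse q) * fps_const (y (Suc i)) * a)" for i
      by (rule hr) (simp add: p_rel(2))
    show "y 1 * y 0 = P * P * y 0 * y 1" using y_serre by (simp add: mult.assoc)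
  qed (rule a_0 a_comm)+
qed

end

lemma commute_mult:
  fixes z :: "'a::semigroup_mult"
  assumes "z * g = g * z" "z * h = h * z"
  shows "z * (g * h) = g * h * z"
  using assms by (metis mult.assoc)

lemma commutator_add_central:
  fixes z :: "'a::ring_1"
  assumes "z * m = m * z" and "z * c = c * z"
  shows "z * (m + c * e) - (m + c * e) * z = c * (z * e - e * z)"
proof -
  have "z * (c * e) = c * (z * e)" using assms(2) by (simp flip: mult.assoc)
  then show ?thesis using assms(1) by (simp add: algebra_simps)
qed

section \<open>The four families and their brackets with \<open>A\<close> and
  \<open>B\<close>\<close>

context serre begin

text \<open>\<open>w n\<close>, \<open>v n\<close>, \<open>g n\<close> and \<open>a $ n\<close> are
  the candidates for \<open>W_{n+1}\<close>, \<open>W_{-n}\<close>, \<open>G_n\<close> and the tilde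
  element of index \<open>n\<close>.\<close>

definition "w = half_current.w s q x a"
definition "v = half_current.w s (inverse q) y a"

text \<open>Obtained by solving the relation for the commutator of \<open>W_0\<close> with
  \<open>W_{k+1}\<close> for \<open>G_{k+1}\<close>.\<close>

definition g where
  "g n = (case n of 0 \<Rightarrow> 1 | Suc k \<Rightarrow> a $ Suc k - s (inverse (1 - inverse q * inverse q)) * (A * w k - w k * A))"

definition "Wp = Abs_fps w"
definition "Wm = Abs_fps v"
definition "Gf = Abs_fps g"
lemma current_nth [simp]: "Wp $ n = w n" "Wm $ n = v n" "Gf $ n = g n"
  by (simp_all add: Wp_def Wm_def Gf_def)
lemma g_0: "g 0 = 1" and g_Suc: "g (Suc k) = a $ Suc k - s (inverse (1 - inverse q * inverse q)) * (A * w k - w k * A)"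
  by (simp_all add: g_def)

interpretation hx: half_current s q x a
  rewrites "half_current.w s q x a = w"
  by (rule half_x) (simp add: w_def)
interpretation hy: half_current s "inverse q" y a
  rewrites "half_current.w s (inverse q) y a = v" and "inverse (inverse q) = q"
  by (rule half_y) (simp_all add: v_def)

interpretation fs: qscalars sc q by (rule qscalars_fps)
interpretation ft: qscalars fs.sc q by (rule fs.qscalars_fps)
interpretation fx: central_unit2 "sc q" "sc (inverse q)" fps_X fps_X
  by (rule hx.fs_unit2) (simp_all add: fps_mult_fps_X_commute)
interpretation tt: central_unit2 "fs.sc q" "fs.sc (inverse q)" "fps_X :: 'a fps fps" "fps_const fps_X"
proof
  show "z * fps_X = fps_X * z" for z :: "'a fps fps" by (rule fps_mult_fps_X_commute[symmetric])
  show "z * fps_const fps_X = fps_const fps_X * z" for z :: "'a fps fps"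
    by (rule fps_ext) (simp add: fps_mult_fps_X_commute[symmetric])
qed

lemma W_eq: "hx.W = Wp" "hy.W = Wm"
  by (simp_all add: fps_eq_iff)

lemma w_def': "(Q - P) * w n = Q * B * a $ n - P * a $ n * B"
  using hx.w_def'[of n] by simp
lemma v_def': "(Q - P) * v n = Q * a $ n * A - P * A * a $ n"
proof -
  have "- ((P - Q) * v n) = - (P * A * a $ n - Q * a $ n * A)" using hy.w_def'[of n] by simp
  then show ?thesis by (simp add: left_diff_distrib)
qed

lemma f1_p: "f1 = (Q - P) * p $ 1" using p_nth[of 1] by (simp add: f_1)
text \<open>Compare linear coefficients in the two equations for the inverse of \<open>p\<close>.
  Thus \<open>f1\<close> is a scalar multiple of \<open>a $ 1\<close>, which links brackets with
  \<open>f1\<close> to those with \<open>a $ 1\<close>.\<close>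

lemma p_1: "p $ 1 = - (Q + P) * a $ 1"
proof -
  have "\<psi> $ 1 = - p $ 1"
    using arg_cong[OF psi_inverse(1), of "\<lambda>h. h $ 1"] by (simp add: psi_0 p_0 eq_neg_iff_add_eq_0 add.commute)
  moreover have "\<psi> $ 1 = (Q + P) * a $ 1"
    unfolding a_product[symmetric] by (simp add: a_0 s_1 algebra_simps)
  ultimately have "p $ 1 = - ((Q + P) * a $ 1)" by (simp add: eq_neg_iff_add_eq_0 add.commute)
  then show ?thesis by (simp only: mult_minus_left)
qed

lemma f1_a: "f1 * a $ n = a $ n * f1"
  unfolding f1_p using p_a_comm[of 1 n] by (simp add: algebra_simps)

lemma A_w: "A * w n - w n * A = v n * B - B * v n"
proof -
  have "(Q - P) * ((A * w n - w n * A) - (v n * B - B * v n)) = 0"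
    by (rule commutators_agree[OF w_def' v_def']) (use f1_a in \<open>simp add: f1_def\<close>)
  then show ?thesis using s_cancel_eq[OF q_neq] unfolding s_diff by blast
qed

lemma a_g: "(1 - P * P) * (a $ Suc k - g (Suc k)) = A * w k - w k * A"
  using s_inverse_cancel[OF q1PP(1)] unfolding s_1PP g_Suc by simp

lemma v_A: "A * v n = v n * A" using hy.x0_w[of n] by simp
lemma w_B: "B * w n = w n * B" using hx.x0_w[of n] by simp

lemma A_g: "(Q - P) * v n = Q * A * g n - P * g n * A"
proof (cases n)
  case 0 then show ?thesis using v_def'[of 0] by (simp add: a_0 g_0)
next
  case (Suc k)
  have "(1-P*P)*((Q*A*g (Suc k) - P*g (Suc k)*A) - (Q*a $ Suc k*A - P*A*a $ Suc k)) = 0"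
  proof (rule qcommutator_AG[OF A_w a_g _ _ v_A])
    show "B*A - Q*Q*A*B = - (Q-P)*(Q+P)*a $ 1" unfolding f1_def[symmetric] f1_p p_1 by (simp add: algebra_simps)
    show "a $ 1 * v k - v k * a $ 1 = a $ Suc k * A - A * a $ Suc k" using hy.a1_w[of k] by simp
  qed
  then have "Q*A*g (Suc k) - P*g (Suc k)*A = Q*a $ Suc k*A - P*A*a $ Suc k"
    using s_cancel_eq[OF q1PP(1)] unfolding s_1PP by blast
  then show ?thesis using v_def'[of n] Suc by simp
qed

lemma g_B: "(Q - P) * w n = Q * g n * B - P * B * g n"
proof (cases n)
  case 0 then show ?thesis using w_def'[of 0] by (simp add: a_0 g_0)
next
  case (Suc k)
  have "(1-P*P)*((Q*g (Suc k)*B - P*B*g (Suc k)) - (Q*B*a $ Suc k - P*a $ Suc k*B)) = 0"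
  proof (rule qcommutator_GB[OF refl a_g _ _ w_B])
    show "B*A - Q*Q*A*B = - (Q-P)*(Q+P)*a $ 1" unfolding f1_def[symmetric] f1_p p_1 by (simp add: algebra_simps)
    show "a $ 1 * w k - w k * a $ 1 = a $ Suc k * B - B * a $ Suc k" using hx.a1_w[of k] by simp
  qed
  then have "Q*g (Suc k)*B - P*B*g (Suc k) = Q*B*a $ Suc k - P*a $ Suc k*B"
    using s_cancel_eq[OF q1PP(1)] unfolding s_1PP by blast
  then show ?thesis using w_def'[of n] Suc by simp
qed

section \<open>Factorisations of \<open>G\<close> and the quantum determinant\<close>

abbreviation "cA \<equiv> fps_const A"

lemma v_fps: "(sc q - sc (inverse q)) * Wm = sc q * a * cA - sc (inverse q) * cA * a"
  by (rule fps_ext) (simp add: sc_def v_def' mult.assoc)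
lemma g_fps: "(1 - sc (inverse q) * sc (inverse q)) * (a - Gf) = fps_X * (cA * Wp - Wp * cA)"
proof (rule fps_ext)
  fix n show "((1 - sc (inverse q) * sc (inverse q)) * (a - Gf)) $ n = (fps_X * (cA * Wp - Wp * cA)) $ n"
    using a_g by (cases n) (simp_all add: a_0 g_0 sc_def left_diff_distrib)
qed

definition S where "S c = Abs_fps (\<lambda>n. s (c ^ n) * p $ Suc n)"

lemma S_fps: "sc c * fps_X * S c = dil c p - 1"
proof (rule fps_ext)
  fix n show "(sc c * fps_X * S c) $ n = (dil c p - 1) $ n"
    by (cases n) (simp_all add: S_def p_0 s_1 s_mult sc_def mult.assoc)
qed

lemma A_Z: "cA * dil c hx.Xf = sc (inverse q) * sc (inverse q) * (dil c hx.Xf * cA - (sc q - sc (inverse q)) * S c)"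
proof (rule fps_ext)
  fix n
  have "(Q - P) * p $ Suc n = x n * A - Q * Q * A * x n"
    using F_eq[of n 0] by (simp add: p_nth F_def)
  then have "s (c^n) * (P * P * ((Q - P) * p $ Suc n)) = s (c^n) * (P * P * (x n * A - Q * Q * A * x n))" by simp
  moreover have "A * (s (c^n) * x n) = s (c^n) * (A * x n)" "(Q - P) * (s (c^n) * p $ Suc n) = s (c^n) * ((Q - P) * p $ Suc n)"
     "P * P * (s (c^n) * z) = s (c^n) * (P * P * z)" for z
    by (metis mult.assoc s_comm)+
  ultimately show "(cA * dil c hx.Xf) $ n = (sc (inverse q) * sc (inverse q) * (dil c hx.Xf * cA - (sc q - sc (inverse q)) * S c)) $ n"
    by (simp add: S_def sc_def right_diff_distrib mult.assoc)
qed

lemma s_sc_1PP: "sc (1 - inverse q * inverse q) = 1 - sc (inverse q) * sc (inverse q)"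
  by (simp add: fs.s_diff fs.s_mult fs.s_1)

text \<open>\<open>W_left\<close> is inserted for \<open>Wp\<close> in \<open>g_fps\<close>;
  \<open>W_right\<close> yields the second factorisation below.\<close>

lemma G_left: "Gf = a * dil q p + sc q * sc q * fps_X * Wm * dil q hx.Xf"
proof -
  have "(1 - sc (inverse q) * sc (inverse q)) * (a - Gf) = fps_X * (cA * (a * dil q hx.Xf) - (a * dil q hx.Xf) * cA)"
    using g_fps unfolding hx.W_left[symmetric] W_eq .
  from fx.gauss_left[OF A_Z v_fps S_fps this] show ?thesis
    unfolding s_sc_1PP[symmetric] by (rule fs.s_cancel_eq[OF q1PP(1)])
qed

lemma G_right: "Gf = dil (inverse q) p * a + fps_X * dil (inverse q) hx.Xf * Wm"
proof -
  have "(1 - sc (inverse q) * sc (inverse q)) * (a - Gf) = fps_X * (cA * (dil (inverse q) hx.Xf * a) - (dil (inverse q) hx.Xf * a) * cA)"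
    using g_fps unfolding hx.W_right[symmetric] W_eq .
  from fx.gauss_right[OF A_Z v_fps S_fps this] show ?thesis
    unfolding s_sc_1PP[symmetric] by (rule fs.s_cancel_eq[OF q1PP(1)])
qed

lemma a_a_p: "dil (inverse q * inverse q) a * (dil (inverse q) p * a) = 1" "a * dil q p * dil (q * q) a = 1"
proof -
  have pa: "dil c p * dil d a = dil d a * dil c p" for c d
    by (rule fps_commute) (use p_a_comm in \<open>simp, metis mult.assoc s_comm\<close>)
  have aa: "dil c a * dil d a = dil d a * dil c a" for c d
    by (rule fps_commute) (use a_comm in \<open>simp, metis mult.assoc s_comm\<close>)
  have "dil q a * dil (inverse q) a * p = 1" using psi_inverse a_product by simp
  then have *: "dil c (dil q a * dil (inverse q) a * p) = 1" for c by (simp add: dil_simps)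
  have "dil (inverse q * inverse q) a * (dil (inverse q) p * a) = a * dil (inverse q * inverse q) a * dil (inverse q) p"
    using pa[of "inverse q" 1] aa[of 1 "inverse q * inverse q"] by (metis dil_1 mult.assoc)
  then show "dil (inverse q * inverse q) a * (dil (inverse q) p * a) = 1"
    using *[of "inverse q"] q0 by (simp add: dil_simps)
  have "a * dil q p * dil (q * q) a = dil (q * q) a * a * dil q p"
    using pa[of q "q * q"] aa[of "q * q" 1] by (metis dil_1 mult.assoc)
  then show "a * dil q p * dil (q * q) a = 1"
    using *[of q] q0 by (simp add: dil_simps)
qed

lemma q_q_inverse: "inverse q * (q * q) = q" "q * (inverse q * inverse q) = inverse q"
  using q0 by (simp_all flip: mult.assoc)

text \<open>Right multiplication of \<open>G_left\<close> by \<open>a(q^2 z)\<close> turns the first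
  term into 1 and, by \<open>W_right\<close>, \<open>X(qz)a(q^2 z)\<close> into
  \<open>W^+(q^2 z)\<close>. Then \<open>z\<close> is replaced by \<open>q^-1 z\<close>.\<close>

lemma qdet: "dil (inverse q) Gf * dil q a = 1 + sc q * fps_X * dil (inverse q) Wm * dil q Wp"
proof -
  have "dil q hx.Xf * dil (q*q) a = dil (q*q) Wp"
    using arg_cong[OF hx.W_right, of "dil (q*q)"] q0 by (simp add: dil_simps W_eq mult.assoc)
  then have "Gf * dil (q*q) a = 1 + sc q * sc q * fps_X * Wm * dil (q*q) Wp"
    using a_a_p(2) by (subst G_left) (simp add: distrib_right mult.assoc)
  from arg_cong[OF this, of "dil (inverse q)"] show ?thesis
    using q0 by (simp add: dil_simps mult.assoc q_q_inverse)
qed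

text \<open>Similarly, \<open>G_right\<close> is multiplied on the left by \<open>a(q^-2 z)\<close>,
  and \<open>W_left\<close> is used. This is the form matching \<open>qdet\<close> after the
  exchange of \<open>A\<close> and \<open>B\<close>.\<close>

lemma qdet': "dil (inverse q) a * dil q Gf = 1 + sc q * fps_X * dil (inverse q) Wp * dil q Wm"
proof -
  have "dil (inverse q*inverse q) a * dil (inverse q) hx.Xf = dil (inverse q*inverse q) Wp"
    using arg_cong[OF hx.W_left, of "dil (inverse q*inverse q)"] q0 by (simp add: dil_simps W_eq mult.assoc)
  then have W: "dil (inverse q*inverse q) a * (dil (inverse q) hx.Xf * z) = dil (inverse q*inverse q) Wp * z" for z
    by (simp flip: mult.assoc)
  have "dil (inverse q*inverse q) a * Gf = 1 + fps_X * dil (inverse q*inverse q) Wp * Wm"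
    using a_a_p(1) by (subst G_right) (simp add: distrib_left mult.assoc W)
  from arg_cong[OF this, of "dil q"] show ?thesis
    using q0 by (simp add: dil_simps mult.assoc q_q_inverse)
qed


section \<open>Commutators of \<open>a(u)\<close> with \<open>G(t)\<close>\<close>

abbreviation "as \<equiv> fps_const a"
abbreviation "Gt \<equiv> outer Gf"
abbreviation "u \<equiv> fps_const fps_X :: 'a fps fps"
abbreviation "qq \<equiv> fs.sc q"
abbreviation "pp \<equiv> fs.sc (inverse q)"

lemma const_outer_comm:
  assumes "\<And>m n. h $ m * k $ n = k $ n * h $ m"
  shows "fps_const h * outer k = outer k * fps_const (h :: 'a fps)"
  by (rule fps_ext, simp, rule fps_ext) (simp add: assms)

lemma a_dil_p: "as * outer (dil c p) = outer (dil c p) * as"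
  by (rule const_outer_comm) (use p_a_comm in \<open>simp, metis mult.assoc s_comm\<close>)
lemma a_a: "as * outer a = outer a * as" by (rule const_outer_comm) (rule a_comm)

lemma outer_sc: "outer (sc c) = fs.sc c"
  by (simp add: fps_eq_iff[of "outer _"] sc_def fs.sc_def)

lemmas outer_simps = outer_mult outer_add outer_sc outer_X

text \<open>In each factorisation of \<open>G(t)\<close> the first term commutes with
  \<open>a(u)\<close>, so only the second contributes. Comparing the two results yields
  \<open>v_w\<close>.\<close>

lemma a_G_comm:
  "(fps_X - u) * (as * Gt - Gt * as) = (qq*qq - 1) * (fps_X * (u * (outer Wm * fps_const Wp - fps_const Wm * outer Wp)))"
  "(fps_X - u) * (as * Gt - Gt * as) = (qq*qq - 1) * (fps_X * (u * (fps_const Wp * outer Wm - outer Wp * fps_const Wm)))"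
proof -
  let ?Z = "outer (dil q hx.Xf)" and ?Z' = "outer (dil (inverse q) hx.Xf)"
  have c: "(fps_X - u) * (qq * qq * fps_X * z) = qq * qq * fps_X * ((fps_X - u) * z)"
    "(fps_X - u) * (fps_X * z) = fps_X * ((fps_X - u) * z)" for z :: "'a fps fps"
    by (simp_all add: algebra_simps)
  have l: "outer Wp = outer a * ?Z" using hx.W_left unfolding W_eq by (simp flip: outer_mult)
  have r: "outer Wp = ?Z' * outer a" using hx.W_right unfolding W_eq by (simp flip: outer_mult)
  have m: "as * (outer a * outer (dil q p)) = outer a * outer (dil q p) * as"
    by (rule commute_mult[OF a_a a_dil_p])
  have G: "Gt = outer a * outer (dil q p) + qq * qq * fps_X * (outer Wm * ?Z)"
    by (subst G_left) (simp only: outer_simps mult.assoc)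
  have "as * Gt - Gt * as = qq * qq * fps_X * (as * (outer Wm * ?Z) - (outer Wm * ?Z) * as)"
    unfolding G by (rule commutator_add_central[OF m]) (simp add: mult.assoc)
  then have "(fps_X - u) * (as * Gt - Gt * as) = qq * qq * fps_X * ((fps_X - u) * (as * (outer Wm * ?Z) - (outer Wm * ?Z) * as))"
    by (simp only: c)
  also have "(fps_X - u) * (as * (outer Wm * ?Z) - (outer Wm * ?Z) * as) = (1-pp*pp)*u*(outer Wm*fps_const Wp - fps_const Wm*outer Wp)"
    by (rule tt.gauss_commutator[OF hx.exchange_outer(1) hx.w_fps2[unfolded W_eq] hy.exchange_W(2)[unfolded W_eq] l])
  finally show "(fps_X - u) * (as * Gt - Gt * as) = (qq*qq - 1) * (fps_X * (u * (outer Wm * fps_const Wp - fps_const Wm * outer Wp)))"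
    by (simp add: algebra_simps)
  have m': "as * (outer (dil (inverse q) p) * outer a) = outer (dil (inverse q) p) * outer a * as"
    by (rule commute_mult[OF a_dil_p a_a])
  have G': "Gt = outer (dil (inverse q) p) * outer a + fps_X * (?Z' * outer Wm)"
    by (subst G_right) (simp only: outer_simps mult.assoc)
  have "as * Gt - Gt * as = fps_X * (as * (?Z' * outer Wm) - (?Z' * outer Wm) * as)"
    unfolding G' by (rule commutator_add_central[OF m']) simp
  then have "(fps_X - u) * (as * Gt - Gt * as) = fps_X * ((fps_X - u) * (as * (?Z' * outer Wm) - (?Z' * outer Wm) * as))"
    by (simp only: c)
  also have "(fps_X - u) * (as * (?Z' * outer Wm) - (?Z' * outer Wm) * as) = (qq*qq-1)*u*(fps_const Wp * outer Wm - outer Wp * fps_const Wm)"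
    by (rule tt.gauss_commutator'[OF hx.exchange_outer(2) hx.w_fps2[unfolded W_eq] hy.exchange_W(1)[unfolded W_eq] r])
  finally show "(fps_X - u) * (as * Gt - Gt * as) = (qq*qq - 1) * (fps_X * (u * (fps_const Wp * outer Wm - outer Wp * fps_const Wm)))"
    by (simp add: algebra_simps)
qed

lemma a_g_shift: "(a $ Suc k * g n - g n * a $ Suc k) - (a $ k * g (Suc n) - g (Suc n) * a $ k) = (Q*Q-1) * (v n * w k - v k * w n)"
  and a_g_shift': "(a $ Suc k * g n - g n * a $ Suc k) - (a $ k * g (Suc n) - g (Suc n) * a $ k) = (Q*Q-1) * (w k * v n - w n * v k)"
proof -
  have c: "qq * qq - 1 = fps_const (fps_const (Q * Q - 1))"
    by (simp add: fs.sc_def sc_def flip: fps_const_sub)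
  note * = a_G_comm[unfolded c left_diff_distrib]
  show "(a $ Suc k * g n - g n * a $ Suc k) - (a $ k * g (Suc n) - g (Suc n) * a $ k) = (Q*Q-1) * (v n * w k - v k * w n)"
    using arg_cong[OF *(1), of "\<lambda>h. h $ Suc n $ Suc k"] by simp
  show "(a $ Suc k * g n - g n * a $ Suc k) - (a $ k * g (Suc n) - g (Suc n) * a $ k) = (Q*Q-1) * (w k * v n - w n * v k)"
    using arg_cong[OF *(2), of "\<lambda>h. h $ Suc n $ Suc k"] by simp
qed

lemma v_w: "(v n * w k - w k * v n) + (w n * v k - v k * w n) = 0"
proof -
  have "s (q * q - 1) * ((v n * w k - v k * w n) - (w k * v n - w n * v k)) = 0"
    unfolding right_diff_distrib s_1QQ using a_g_shift[of k n] a_g_shift'[of k n] by (simp add: right_diff_distrib)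
  from s_cancel_eq[OF q1PP(2) this] show ?thesis by (simp add: algebra_simps)
qed

text \<open>\<open>a_g_shift\<close> moves one unit of index from \<open>a\<close> to
  \<open>g\<close>. Its correction term is antisymmetric in \<open>k\<close> and \<open>n\<close>,
  so it cancels between the two sides.\<close>

lemma a_g_symmetric: "a $ k * g n - g n * a $ k = a $ n * g k - g k * a $ n"
proof (induct k arbitrary: n)
  case 0 show ?case by (simp add: a_0 g_0)
next
  case (Suc k)
  have "a $ Suc k * g n - g n * a $ Suc k = (a $ k * g (Suc n) - g (Suc n) * a $ k) + (Q*Q-1) * (v n * w k - v k * w n)"
    using a_g_shift[of k n] by (simp add: algebra_simps)
  moreover have "a $ n * g (Suc k) - g (Suc k) * a $ n = (a $ Suc n * g k - g k * a $ Suc n) - (Q*Q-1) * (v k * w n - v n * w k)"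
    using a_g_shift[of n k] by (simp add: algebra_simps)
  moreover have "(Q*Q-1) * (v k * w n - v n * w k) = - ((Q*Q-1) * (v n * w k - v k * w n))"
    by (simp flip: mult_minus_right)
  ultimately show ?case using Suc[of "Suc n"] by simp
qed

lemma w_comm: "w k * w n = w n * w k" by (rule hx.w_comm)
lemma v_comm: "v k * v n = v n * v k" by (rule hy.w_comm)
lemma a_w_symmetric: "a $ Suc k * w n - w n * a $ Suc k = a $ Suc n * w k - w k * a $ Suc n"
  by (rule hx.a_w_symmetric)
lemma a_v_symmetric: "a $ Suc k * v n - v n * a $ Suc k = a $ Suc n * v k - v k * a $ Suc n"
  by (rule hy.a_w_symmetric)

section \<open>The symmetry exchanging \<open>A\<close> and \<open>B\<close>, and the recursion for
  \<open>G\<close>\<close>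

lemma serre_swap: "serre s q B A"
  by unfold_locales (rule serre_B serre_A)+

lemma fps_mult_nth_Suc: "(h * k) $ Suc n = h $ 0 * k $ Suc n + h $ Suc n * k $ 0 + (\<Sum>i\<in>{1..<Suc n}. h $ i * k $ (Suc n - i))"
  for h k :: "'a fps"
proof -
  have "{0..Suc n} = insert 0 (insert (Suc n) {1..<Suc n})" by auto
  then show ?thesis by (simp add: fps_mult_nth add.assoc)
qed

lemma v_0: "v 0 = A" and w_0: "w 0 = B"
proof -
  have "s (q - inverse q) * (v 0 - A) = 0" "s (q - inverse q) * (w 0 - B) = 0"
    using v_def'[of 0] w_def'[of 0] by (simp_all add: s_diff a_0 right_diff_distrib left_diff_distrib)
  then show "v 0 = A" "w 0 = B" using s_cancel_eq[OF q_neq] by blast+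
qed

text \<open>Both sides satisfy the recursion determined by \<open>qdet\<close> and \<open>a_g\<close>.\<close>

lemma swapped:
  "serre.a s q B A $ n = g n \<and> serre.g s q B A n = a $ n \<and> serre.w s q B A n = v n \<and> serre.v s q B A n = w n"
proof (induct n rule: less_induct)
  case (less n)
  interpret sw: serre s q B A by (rule serre_swap)
  have "sw.a $ n = g n \<and> sw.g n = a $ n"
  proof (cases n)
    case 0 then show ?thesis by (simp add: a_0 g_0 sw.a_0 sw.g_0)
  next
    case (Suc k)
    have "(1 - P * P) * (g n - a $ n) = - ((1 - P * P) * (a $ n - g n))" by (simp flip: mult_minus_right)
    then have "(1 - P * P) * (g n - a $ n) = B * v k - v k * B" using a_g[of k] A_w[of k] Suc by simp
    moreover have "(1 - P * P) * (sw.a $ n - sw.g n) = B * v k - v k * B"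
      using sw.a_g[of k] less[of k] Suc by simp
    ultimately have "(1 - P * P) * ((sw.a $ n - sw.g n) - (g n - a $ n)) = 0"
      by (simp only: right_diff_distrib[of _ "sw.a $ n - sw.g n"] diff_self)
    then have "sw.a $ n - sw.g n = g n - a $ n"
      unfolding s_1PP[symmetric] by (rule s_cancel_eq[OF q1PP(1)])
    then have d: "sw.a $ n - g n = sw.g n - a $ n" by (simp add: algebra_simps)
    have "(dil (inverse q) sw.Wp * dil q sw.Wm) $ k = (dil (inverse q) Wm * dil q Wp) $ k"
      unfolding fps_mult_nth by (intro sum.cong) (use less Suc in simp_all)
    \<comment> \<open>The companion identity of the swapped pair is compared with
      \<open>qdet\<close> of the original one; the right-hand sides involve only indices at most
      \<open>k\<close>, where induction applies.\<close>
    then have "(dil (inverse q) sw.a * dil q sw.Gf) $ Suc k = (dil (inverse q) Gf * dil q a) $ Suc k"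
      unfolding qdet sw.qdet' by (simp add: sc_def mult.assoc)
    moreover have "(\<Sum>i\<in>{1..<Suc k}. dil (inverse q) sw.a $ i * dil q sw.Gf $ (Suc k - i))
      = (\<Sum>i\<in>{1..<Suc k}. dil (inverse q) Gf $ i * dil q a $ (Suc k - i))"
      by (intro sum.cong) (use less Suc in simp_all)
    ultimately have "s (q ^ n) * sw.g n + s (inverse q ^ n) * sw.a $ n = s (q ^ n) * a $ n + s (inverse q ^ n) * g n"
      unfolding fps_mult_nth_Suc Suc by (simp add: s_1 sw.a_0 a_0 sw.g_0 g_0)
    then have "s (q ^ n) * (sw.g n - a $ n) + s (inverse q ^ n) * (sw.a $ n - g n) = 0"
      by (simp add: algebra_simps)
    \<comment> \<open>By \<open>d\<close> the two differences coincide, and their common factor is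
      invertible.\<close>
    then have "s (q ^ n + inverse q ^ n) * (sw.g n - a $ n) = 0"
      unfolding d by (simp add: s_add distrib_right)
    then have "sw.g n = a $ n" using s_cancel_eq[OF q_sum[of n]] Suc by blast
    then show ?thesis using d by simp
  qed
  then have *: "sw.a $ n = g n" "sw.g n = a $ n" by auto
  have "s (q - inverse q) * (sw.w n - v n) = 0" "s (q - inverse q) * (sw.v n - w n) = 0"
    using sw.w_def'[of n] sw.v_def'[of n] A_g[of n] g_B[of n] * by (simp_all add: right_diff_distrib s_diff)
  then show ?case using * s_cancel_eq[OF q_neq] by blast
qed

text \<open>These are the relations of \<open>a\<close> with \<open>w\<close>, \<open>v\<close> and
  itself, transported by the exchange of \<open>A\<close> and \<open>B\<close>.\<close>

lemma g_v_symmetric: "g (Suc k) * v n - v n * g (Suc k) = g (Suc n) * v k - v k * g (Suc n)"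
  and g_w_symmetric: "g (Suc k) * w n - w n * g (Suc k) = g (Suc n) * w k - w k * g (Suc n)"
  and g_comm: "g m * g n = g n * g m"
  using serre.a_w_symmetric[OF serre_swap, of k n] serre.a_v_symmetric[OF serre_swap, of k n]
    serre.a_comm[OF serre_swap, of m n] swapped by simp_all

text \<open>The coefficient of degree \<open>n\<close> in \<open>qdet\<close> contains
  \<open>q^n * gt n + q^-n * g n\<close>. Replacing \<open>gt n\<close> by \<open>g n\<close> plus a
  commutator gives \<open>g n\<close> the factor \<open>q^n + q^-n\<close>.\<close>

lemma g_recursion:
  assumes "n > 0"
  shows "g n = s (inverse (q powi int n + q powi (- int n))) *
      (s q * (\<Sum>k\<in>{0..<n}. s (q powi (int n - 1 - 2 * int k)) * (v k * w (n - k - 1)))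
        - (\<Sum>k\<in>{1..<n}. s (q powi (int n - 2 * int k)) * (g k * gt (n - k))))
     + s (inverse ((1 + q powi (- 2 * int n)) * (1 - q powi (-2)))) * (w (n - 1) * A - A * w (n - 1))"
proof -
  obtain m where m: "n = Suc m" using assms by (cases n) auto
  have pw: "s (inverse q ^ i) * y * (s (q ^ j) * z) = s (q powi (int j - int i)) * (y * z)" for i j y z
  proof -
    have "q powi (int j - int i) = inverse q ^ i * q ^ j"
      using q0 by (simp add: power_int_diff field_simps power_inverse)
    then show ?thesis by (simp add: s_mult mult.assoc) (metis mult.assoc s_comm)
  qed
  have "(dil (inverse q) Gf * dil q a) $ n = s (q ^ n) * gt n + s (inverse q ^ n) * g n + (\<Sum>k\<in>{1..<n}. s (q powi (int n - 2 * int k)) * (g k * gt (n - k)))"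
    unfolding m fps_mult_nth_Suc
    by (auto simp: s_1 a_0 g_0 pw a_nth[symmetric] intro!: sum.cong arg_cong2[of _ _ _ _ "(*)"] arg_cong[of _ _ s] arg_cong2[of _ _ _ _ "(powi)"])
  moreover have "(dil (inverse q) Gf * dil q a) $ n = s q * (\<Sum>k\<in>{0..<n}. s (q powi (int n - 1 - 2 * int k)) * (v k * w (n - k - 1)))"
  proof -
    have "(dil (inverse q) Gf * dil q a) $ n = s q * (dil (inverse q) Wm * dil q Wp) $ m"
      unfolding qdet m by (simp add: sc_def mult.assoc)
    also have "(dil (inverse q) Wm * dil q Wp) $ m = (\<Sum>k\<in>{0..<n}. s (q powi (int n - 1 - 2 * int k)) * (v k * w (n - k - 1)))"
      unfolding m fps_mult_nth atLeastLessThanSuc_atLeastAtMost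
      by (auto simp: pw intro!: sum.cong arg_cong2[of _ _ _ _ "(*)"] arg_cong[of _ _ s] arg_cong2[of _ _ _ _ "(powi)"])
    finally show ?thesis .
  qed
  moreover define S1 S2 where "S1 = (\<Sum>k\<in>{0..<n}. s (q powi (int n - 1 - 2 * int k)) * (v k * w (n - k - 1)))"
    and "S2 = (\<Sum>k\<in>{1..<n}. s (q powi (int n - 2 * int k)) * (g k * gt (n - k)))"
  define D where "D = A * w m - w m * A"
  have gt: "gt n = g n + s (inverse (1 - inverse q * inverse q)) * D"
    unfolding m g_Suc D_def by (simp add: a_nth)
  ultimately have "s (q ^ n + inverse q ^ n) * g n = s q * S1 - S2 - s (q ^ n) * (s (inverse (1 - inverse q * inverse q)) * D)"
    unfolding S1_def S2_def gt by (simp add: s_add algebra_simps)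
  then have "g n = s (inverse (q ^ n + inverse q ^ n)) * (s q * S1 - S2) - s (inverse (q ^ n + inverse q ^ n)) * (s (q ^ n) * (s (inverse (1 - inverse q * inverse q)) * D))"
    using s_inverse_cancel'[OF q_sum[OF assms], of "g n"] by (simp add: right_diff_distrib)
  moreover have "s (inverse (q ^ n + inverse q ^ n)) * (s (q ^ n) * (s (inverse (1 - inverse q * inverse q)) * D))
    = s (inverse ((1 + q powi (- 2 * int n)) * (1 - q powi (-2)))) * D"
  proof -
    have "inverse (q ^ n + inverse q ^ n) * (q ^ n * inverse (1 - inverse q * inverse q)) = inverse ((1 + q powi (- 2 * int n)) * (1 - q powi (-2)))"
    proof -
      have 1: "q powi (- 2 * int n) = inverse q ^ n * inverse q ^ n"
        by (simp add: power_int_minus power_int_mult power_inverse mult.commute[of 2] flip: power_mult power2_eq_square)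
      have "q ^ n + inverse q ^ n = q ^ n * (1 + inverse q ^ n * inverse q ^ n)"
        using q0 by (simp add: algebra_simps flip: power_mult_distrib mult.assoc)
      then show ?thesis unfolding 1 using q0 by (simp add: power_int_minus power2_eq_square)
    qed
    then show ?thesis by (simp flip: s_mult mult.assoc)
  qed
  moreover have "q powi int n = q ^ n" "q powi (- int n) = inverse q ^ n"
    by (simp_all add: power_int_minus power_inverse)
  moreover have "s c * (w (n - 1) * A - A * w (n - 1)) = - (s c * D)" for c
    by (simp add: D_def m flip: mult_minus_right)
  ultimately show ?thesis
    unfolding S1_def S2_def by (simp only: diff_conv_add_uminus)
qed

end

section \<open>Presented algebras\<close>

lemma rel_ideal_0: "0 \<in> rel_ideal S"
  and rel_ideal_add: "x \<in> rel_ideal S \<Longrightarrow> y \<in> rel_ideal S \<Longrightarrow> x + y \<in> rel_ideal S"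
  and rel_ideal_mult_left: "x \<in> rel_ideal S \<Longrightarrow> z * x \<in> rel_ideal S"
  and rel_ideal_mult_right: "x \<in> rel_ideal S \<Longrightarrow> x * z \<in> rel_ideal S"
proof -
  interpret ideal "rel_ideal S" free_alg by (rule ideal_rel_ideal)
  show "0 \<in> rel_ideal S" using additive_subgroup.zero_closed[OF is_additive_subgroup] by (simp add: free_alg_def)
  show "x \<in> rel_ideal S \<Longrightarrow> y \<in> rel_ideal S \<Longrightarrow> x + y \<in> rel_ideal S"
    using additive_subgroup.a_closed[OF is_additive_subgroup, of x y] by (simp add: free_alg_def)
  show "x \<in> rel_ideal S \<Longrightarrow> z * x \<in> rel_ideal S" "x \<in> rel_ideal S \<Longrightarrow> x * z \<in> rel_ideal S"
    using I_l_closed[of x z] I_r_closed[of x z] by (simp_all add: free_alg_def)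
qed

lemma rel_ideal_uminus: "x \<in> rel_ideal S \<Longrightarrow> - x \<in> rel_ideal S"
  using rel_ideal_mult_left[of x S "-1"] by simp
lemma rel_ideal_diff: "x \<in> rel_ideal S \<Longrightarrow> y \<in> rel_ideal S \<Longrightarrow> x - y \<in> rel_ideal S"
  using rel_ideal_add[OF _ rel_ideal_uminus, of x S y] by simp

lemma rel_ideal_rel: "(l, r) \<in> S \<Longrightarrow> l - r \<in> rel_ideal S"
  using ring.genideal_self[OF ring_free_alg, of "{l - r | l r. (l, r) \<in> S}"]
  unfolding rel_ideal_def by (auto simp: free_alg_def)

lemma rel_ideal_least:
  fixes S :: "('f::field, 'x) relations"
  assumes "0 \<in> K" "\<And>x y. x \<in> K \<Longrightarrow> y \<in> K \<Longrightarrow> x + y \<in> K" "\<And>x z. x \<in> K \<Longrightarrow> z * x \<in> K" "\<And>x z. x \<in> K \<Longrightarrow> x * z \<in> K"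
    and "\<And>l r. (l, r) \<in> S \<Longrightarrow> l - r \<in> K"
  shows "rel_ideal S \<subseteq> K"
proof -
  interpret ring "free_alg :: ('f, 'x word \<Rightarrow>\<^sub>0 'f) module" by (rule ring_free_alg)
  have "- x \<in> K" if "x \<in> K" for x using assms(3)[OF that, of "-1"] by simp
  moreover have "inv\<^bsub>add_monoid free_alg\<^esub> x = - x" for x :: "'x word \<Rightarrow>\<^sub>0 'f"
    unfolding a_inv_def[symmetric] by (rule minus_equality) (simp_all add: free_alg_def)
  ultimately have "subgroup K (add_monoid (free_alg :: ('f, 'x word \<Rightarrow>\<^sub>0 'f) module))"
    using assms(1,2) by (intro subgroup.intro) (auto simp: free_alg_def)
  then have "ideal K (free_alg :: ('f, 'x word \<Rightarrow>\<^sub>0 'f) module)"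
    by (rule idealI[OF ring_free_alg]) (use assms(3,4) in \<open>auto simp: free_alg_def\<close>)
  then show ?thesis
    unfolding rel_ideal_def by (intro ring.genideal_minimal[OF ring_free_alg]) (use assms(5) in auto)
qed

lemma coset_eq_iff: "coset S p = coset S r \<longleftrightarrow> p - r \<in> rel_ideal S"
proof -
  interpret ideal "rel_ideal S" free_alg by (rule ideal_rel_ideal)
  have self: "r \<in> coset S r" for r
    unfolding coset_def by (rule a_rcos_self) (simp add: free_alg_def)
  have mem: "x \<in> coset S r \<longleftrightarrow> x - r \<in> rel_ideal S" for x r
    unfolding coset_def a_r_coset_def r_coset_def by (auto simp: free_alg_def algebra_simps intro: bexI[of _ "x - r"])
  show ?thesis
  proof
    assume "p - r \<in> rel_ideal S"
    then have "p \<in> coset S r" by (simp add: mem)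
    then show "coset S p = coset S r"
      unfolding coset_def by (intro a_repr_independence'[symmetric]) (auto simp: free_alg_def)
  qed (metis self mem)
qed

lemma presented_alg_simps:
  "carrier (presented_alg S) = range (coset S)"
  "coset S p \<otimes>\<^bsub>presented_alg S\<^esub> coset S r = coset S (p * r)"
  "coset S p \<oplus>\<^bsub>presented_alg S\<^esub> coset S r = coset S (p + r)"
  "\<one>\<^bsub>presented_alg S\<^esub> = coset S 1"
  "\<zero>\<^bsub>presented_alg S\<^esub> = coset S 0"
proof -
  interpret ideal "rel_ideal S" free_alg by (rule ideal_rel_ideal)
  note d = presented_alg_def ring.defs module.defs FactRing_def
  show "carrier (presented_alg S) = range (coset S)"
    by (auto simp: d A_RCOSETS_def' coset_def free_alg_def a_r_coset_def)
  show "coset S p \<otimes>\<^bsub>presented_alg S\<^esub> coset S r = coset S (p * r)"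
    using rcoset_mult_add[of p r] by (simp add: d coset_def free_alg_def)
  show "coset S p \<oplus>\<^bsub>presented_alg S\<^esub> coset S r = coset S (p + r)"
    using a_rcos_sum[of p r] by (simp add: d coset_def free_alg_def)
  show "\<one>\<^bsub>presented_alg S\<^esub> = coset S 1"
    by (simp add: d coset_def free_alg_def)
  show "\<zero>\<^bsub>presented_alg S\<^esub> = coset S 0"
    by (simp add: d coset_def) (simp add: free_alg_def a_r_coset_def r_coset_def)
qed

lemma ring_presented_alg: "ring (presented_alg S)"
proof (rule ringI)
  have neg: "\<exists>r. coset S (r + p) = coset S 0" for p by (rule exI[of _ "- p"]) simp
  show "abelian_group (presented_alg S)"
    using neg by (intro abelian_groupI) (auto simp: presented_alg_simps algebra_simps)
  show "Group.monoid (presented_alg S)"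
    by (rule monoidI) (auto simp: presented_alg_simps mult.assoc)
qed (auto simp: presented_alg_simps algebra_simps)

lemma coset_diff: "coset S p \<ominus>\<^bsub>presented_alg S\<^esub> coset S r = coset S (p - r)"
proof -
  interpret ring "presented_alg S" by (rule ring_presented_alg)
  have "\<ominus>\<^bsub>presented_alg S\<^esub> coset S r = coset S (- r)"
    by (rule minus_equality) (auto simp: presented_alg_simps)
  then show ?thesis by (simp add: a_minus_def presented_alg_simps)
qed

lemma scal_mult: "scal (c * d) = scal c * scal d"
  and scal_add: "scal (c + d) = scal c + scal d"
  and scal_1: "scal 1 = 1"
  by (simp_all add: scal_def mult_single single_add)

lemma free_alg_induct [case_names gen scal add mult]:
  fixes p :: "'x word \<Rightarrow>\<^sub>0 'f::field"
  assumes "\<And>x. Pr (gen x)" "\<And>c. Pr (scal c)" "\<And>p r. Pr p \<Longrightarrow> Pr r \<Longrightarrow> Pr (p + r)" "\<And>p r. Pr p \<Longrightarrow> Pr r \<Longrightarrow> Pr (p * r)"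
  shows "Pr p"
proof -
  have word: "Pr (Poly_Mapping.single (Word ws) 1)" for ws
  proof (induct ws)
    case Nil
    then show ?case using assms(2)[of 1] by (simp add: scal_def zero_word_def)
  next
    case (Cons x ws)
    then have "Pr (gen x * Poly_Mapping.single (Word ws) 1)" using assms by blast
    then show ?case by (simp add: gen_def mult_single plus_word_def)
  qed
  have single: "Pr (Poly_Mapping.single m c)" for m c
  proof -
    have "Pr (scal c * Poly_Mapping.single (Word (letters m)) 1)" using assms word by blast
    then show ?thesis by (simp add: scal_def mult_single)
  qed
  show ?thesis
  proof (induct p rule: update_induct)
    case const
    then show ?case using assms(2)[of 0] by (simp add: scal_def)
  next
    case (update p m c)
    have "Poly_Mapping.update m c p = p + Poly_Mapping.single m c"
      using update by (auto simp: poly_mapping_eq_iff fun_eq_iff lookup_update lookup_add lookup_single when_def in_keys_iff)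
    then show ?case using assms(3)[OF update(3) single] by simp
  qed
qed

lemma scal_comm: "p * scal c = scal c * p"
  by (induct p rule: free_alg_induct)
     (simp_all add: algebra_simps gen_def scal_def mult_single, (simp add: mult.assoc[symmetric])?)

text \<open>The carrier of a presented algebra depends on its relations, so it is not a type.  The product of the
  presented algebras over all sets of relations is one, and it is an instance of \<^class>\<open>ring_1\<close>.\<close>

lifting_forget poly_mapping.lifting

definition family_rel :: "(('f::field, 'x) relations \<Rightarrow> 'x word \<Rightarrow>\<^sub>0 'f) \<Rightarrow> (('f, 'x) relations \<Rightarrow> 'x word \<Rightarrow>\<^sub>0 'f) \<Rightarrow> bool"
  where "family_rel a b \<longleftrightarrow> (\<forall>S. a S - b S \<in> rel_ideal S)"

lemma equivp_family_rel: "equivp (family_rel :: (('f::field, 'x) relations \<Rightarrow> _) \<Rightarrow> _)"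
proof -
  have "family_rel a a" for a :: "('f, 'x) relations \<Rightarrow> 'x word \<Rightarrow>\<^sub>0 'f"
    by (simp add: family_rel_def rel_ideal_0)
  moreover have "family_rel a b \<Longrightarrow> family_rel b a" for a b :: "('f, 'x) relations \<Rightarrow> 'x word \<Rightarrow>\<^sub>0 'f"
    unfolding family_rel_def by (metis minus_diff_eq rel_ideal_uminus)
  moreover have "family_rel a b \<Longrightarrow> family_rel b c \<Longrightarrow> family_rel a c" for a b c :: "('f, 'x) relations \<Rightarrow> 'x word \<Rightarrow>\<^sub>0 'f"
    using rel_ideal_add[of "a S - b S" S "b S - c S" for S] by (simp add: family_rel_def)
  ultimately show ?thesis by (intro equivpI reflpI sympI transpI) blast+
qed

quotient_type (overloaded) ('f, 'x) presented_family = "('f::field, 'x) relations \<Rightarrow> 'x word \<Rightarrow>\<^sub>0 'f" / family_rel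
  by (rule equivp_family_rel)

instantiation presented_family :: (field, type) ring_1
begin

lift_definition zero_presented_family :: "('a, 'b) presented_family" is "\<lambda>S. 0" .
lift_definition one_presented_family :: "('a, 'b) presented_family" is "\<lambda>S. 1" .
lift_definition plus_presented_family :: "('a, 'b) presented_family \<Rightarrow> ('a, 'b) presented_family \<Rightarrow> ('a, 'b) presented_family"
  is "\<lambda>a b S. a S + b S"
  unfolding family_rel_def by (metis add_diff_add rel_ideal_add)
lift_definition minus_presented_family :: "('a, 'b) presented_family \<Rightarrow> ('a, 'b) presented_family \<Rightarrow> ('a, 'b) presented_family"
  is "\<lambda>a b S. a S - b S"
proof -
  fix a a' b b' :: "('a, 'b) relations \<Rightarrow> 'b word \<Rightarrow>\<^sub>0 'a"
  assume "family_rel a a'" "family_rel b b'"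
  moreover have "a S - b S - (a' S - b' S) = (a S - a' S) - (b S - b' S)" for S by simp
  ultimately show "family_rel (\<lambda>S. a S - b S) (\<lambda>S. a' S - b' S)"
    unfolding family_rel_def by (metis rel_ideal_diff)
qed
lift_definition uminus_presented_family :: "('a, 'b) presented_family \<Rightarrow> ('a, 'b) presented_family"
  is "\<lambda>a S. - a S"
  unfolding family_rel_def by (metis minus_diff_minus rel_ideal_uminus)
lift_definition times_presented_family :: "('a, 'b) presented_family \<Rightarrow> ('a, 'b) presented_family \<Rightarrow> ('a, 'b) presented_family"
  is "\<lambda>a b S. a S * b S"
proof -
  fix a a' b b' :: "('a, 'b) relations \<Rightarrow> 'b word \<Rightarrow>\<^sub>0 'a"
  assume "family_rel a a'" "family_rel b b'"
  moreover have "a S * b S - a' S * b' S = (a S - a' S) * b S + a' S * (b S - b' S)" for S by (simp add: algebra_simps)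
  ultimately show "family_rel (\<lambda>S. a S * b S) (\<lambda>S. a' S * b' S)"
    unfolding family_rel_def by (metis rel_ideal_add rel_ideal_mult_left rel_ideal_mult_right)
qed

instance
proof
  \<comment> \<open>The factor without relations is the free algebra, so the product is not the zero
    ring.\<close>
  have "(1 :: 'b word \<Rightarrow>\<^sub>0 'a) \<notin> rel_ideal {}"
    using rel_ideal_least[of "{0 :: 'b word \<Rightarrow>\<^sub>0 'a}" "{}"] by auto
  then show "(0 :: ('a, 'b) presented_family) \<noteq> 1"
    by transfer (use rel_ideal_uminus[of "-1"] in \<open>force simp: family_rel_def\<close>)
qed (transfer, simp add: family_rel_def algebra_simps rel_ideal_0)+

end

lift_definition at_rels :: "('f::field, 'x) relations \<Rightarrow> ('f, 'x) presented_family \<Rightarrow> ('x word \<Rightarrow>\<^sub>0 'f) set"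
  is "\<lambda>S a. coset S (a S)"
  by (simp add: family_rel_def coset_eq_iff)

lift_definition fscal :: "'f::field \<Rightarrow> ('f, 'x) presented_family" is "\<lambda>c S. scal c" .

text \<open>Extension by 0 makes the Serre relations hold in the whole product: in the factor
  \<open>plus_rels q\<close> by definition, in all others trivially.\<close>

lift_definition gen_at :: "('f::field, 'x) relations \<Rightarrow> 'x \<Rightarrow> ('f, 'x) presented_family"
  is "\<lambda>S x S'. if S' = S then gen x else 0" .

lemma at_rels_simps:
  "at_rels S a \<otimes>\<^bsub>presented_alg S\<^esub> at_rels S b = at_rels S (a * b)"
  "at_rels S a \<oplus>\<^bsub>presented_alg S\<^esub> at_rels S b = at_rels S (a + b)"
  "at_rels S a \<ominus>\<^bsub>presented_alg S\<^esub> at_rels S b = at_rels S (a - b)"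
  "c \<odot>\<^bsub>presented_alg S\<^esub> at_rels S a = at_rels S (fscal c * a)"
  "\<one>\<^bsub>presented_alg S\<^esub> = at_rels S 1"
  by (transfer, simp add: presented_alg_simps coset_diff smult_coset)+

lemma at_rels_carrier: "at_rels S a \<in> carrier (presented_alg S)"
  by transfer (simp add: presented_alg_simps)

lemma finsum_at_rels:
  "finite I \<Longrightarrow> finsum (presented_alg S) (\<lambda>i. at_rels S (h i)) I = at_rels S (\<Sum>i\<in>I. h i)"
proof (induct I rule: finite_induct)
  interpret ring "presented_alg S" by (rule ring_presented_alg)
  have z: "\<zero>\<^bsub>presented_alg S\<^esub> = at_rels S 0" by transfer (simp add: presented_alg_simps)
  {
    case empty show ?case by (simp add: z)
  next
    case (insert i I) then show ?case
      by (subst finsum_insert) (auto simp: at_rels_simps at_rels_carrier)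
  }
qed

lemma at_rels_gen_at: "at_rels S (gen_at S x) = coset S (gen x)"
  by transfer simp

lemma scalars_fscal: "scalars (fscal :: 'f::field \<Rightarrow> ('f, 'x) presented_family)"
proof
  fix z :: "('f, 'x) presented_family" and c d :: 'f
  show "fscal (c + d) = (fscal c + fscal d :: ('f, 'x) presented_family)"
    "fscal (c * d) = (fscal c * fscal d :: ('f, 'x) presented_family)"
    "fscal 1 = (1 :: ('f, 'x) presented_family)"
    by (transfer, simp add: family_rel_def scal_add scal_mult scal_1 rel_ideal_0)+
  show "z * fscal c = fscal c * z"
    by transfer (unfold family_rel_def, intro allI, subst scal_comm, simp add: rel_ideal_0)
qed

lemma serre_gen_at:
  fixes q :: "'f::field"
  assumes "q \<noteq> 0" and "\<And>n::nat. n > 0 \<Longrightarrow> q ^ n \<noteq> 1"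
  defines "S \<equiv> plus_rels q"
  shows "serre fscal q (gen_at S Agen) (gen_at S Bgen)"
proof -
  interpret scalars "fscal :: 'f \<Rightarrow> ('f, plus_gen) presented_family" by (rule scalars_fscal)
  let ?A = "gen Agen :: plus_gen word \<Rightarrow>\<^sub>0 'f" and ?B = "gen Bgen :: plus_gen word \<Rightarrow>\<^sub>0 'f"
  have "(comm ?A (qcomm (inverse q) ?A (qcomm q ?A ?B)), 0) \<in> S" "(comm ?B (qcomm (inverse q) ?B (qcomm q ?B ?A)), 0) \<in> S"
    by (simp_all add: S_def plus_rels_def Let_def)
  from rel_ideal_rel[OF this(1)] rel_ideal_rel[OF this(2)]
  have r: "comm ?A (qcomm (inverse q) ?A (qcomm q ?A ?B)) \<in> rel_ideal S" "comm ?B (qcomm (inverse q) ?B (qcomm q ?B ?A)) \<in> rel_ideal S"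
    by simp_all
  have eq: "gen_at S x * (fscal (inverse q) * (gen_at S x * (fscal q * gen_at S x * gen_at S z - fscal (inverse q) * gen_at S z * gen_at S x))
        - fscal q * ((fscal q * gen_at S x * gen_at S z - fscal (inverse q) * gen_at S z * gen_at S x) * gen_at S x))
      = (fscal (inverse q) * (gen_at S x * (fscal q * gen_at S x * gen_at S z - fscal (inverse q) * gen_at S z * gen_at S x))
        - fscal q * ((fscal q * gen_at S x * gen_at S z - fscal (inverse q) * gen_at S z * gen_at S x) * gen_at S x)) * gen_at S x"
    if "comm (gen x) (qcomm (inverse q) (gen x) (qcomm q (gen x) (gen z))) \<in> rel_ideal S" for x z
    using that
    by transfer (simp add: family_rel_def comm_def qcomm_def mult.assoc rel_ideal_0)
  show ?thesis
  proof
    show "q \<noteq> 0" "n > 0 \<Longrightarrow> q ^ n \<noteq> 1" for n by (fact assms)+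
  qed (rule eq r)+
qed

section \<open>Evaluation homomorphisms from the free algebra\<close>

locale free_eval = scalars s for s :: "'f::field \<Rightarrow> 'a::ring_1" +
  fixes \<phi> :: "'x \<Rightarrow> 'a"
begin

definition ev :: "('x word \<Rightarrow>\<^sub>0 'f) \<Rightarrow> 'a" where
  "ev p = (\<Sum>m\<in>Poly_Mapping.keys p. s (Poly_Mapping.lookup p m) * prod_list (map \<phi> (letters m)))"

lemma ev_superset:
  assumes "finite K" "Poly_Mapping.keys p \<subseteq> K"
  shows "ev p = (\<Sum>m\<in>K. s (Poly_Mapping.lookup p m) * prod_list (map \<phi> (letters m)))"
  unfolding ev_def using assms by (intro sum.mono_neutral_left) (auto simp: in_keys_iff s_0)

lemma ev_add: "ev (p + r) = ev p + ev r"
proof -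
  let ?K = "Poly_Mapping.keys p \<union> Poly_Mapping.keys r"
  have "ev (p + r) = (\<Sum>m\<in>?K. s (Poly_Mapping.lookup (p + r) m) * prod_list (map \<phi> (letters m)))"
    by (rule ev_superset) (simp_all add: Poly_Mapping.keys_add)
  then show ?thesis
    using ev_superset[of ?K p] ev_superset[of ?K r]
    by (simp add: lookup_add s_add distrib_right sum.distrib)
qed

lemma ev_single: "ev (Poly_Mapping.single m c) = s c * prod_list (map \<phi> (letters m))"
  by (subst ev_superset[of "{m}"]) (auto simp: lookup_single)

lemma ev_0: "ev 0 = 0" by (simp add: ev_def)
lemma ev_scal: "ev (scal c) = s c" by (simp add: scal_def ev_single zero_word_def)
lemma ev_gen: "ev (gen x) = \<phi> x" by (simp add: gen_def ev_single s_1)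
lemma ev_1: "ev 1 = 1" using ev_scal[of 1] by (simp add: scal_1 s_1)
lemma ev_uminus: "ev (- p) = - ev p" using ev_add[of p "- p"] by (simp add: ev_0 eq_neg_iff_add_eq_0 add.commute)
lemma ev_diff: "ev (p - r) = ev p - ev r" using ev_add[of p "- r"] by (simp add: ev_uminus)

lemma ev_mult: "ev (p * r) = ev p * ev r"
proof (induct p arbitrary: r rule: free_alg_induct)
  case (gen x)
  show ?case
  proof (induct r rule: update_induct)
    case const show ?case by (simp add: ev_0)
  next
    case (update r m c)
    have u: "Poly_Mapping.update m c r = r + Poly_Mapping.single m c"
      using update by (auto simp: poly_mapping_eq_iff fun_eq_iff lookup_update lookup_add lookup_single when_def in_keys_iff)
    have "gen x * Poly_Mapping.single m c = Poly_Mapping.single (Word (x # letters m)) c"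
      by (simp add: gen_def mult_single plus_word_def)
    then have "ev (gen x * Poly_Mapping.single m c) = ev (gen x) * ev (Poly_Mapping.single m c)"
      unfolding ev_gen by (simp add: ev_single) (metis mult.assoc s_comm)
    then show ?case using update by (simp add: u distrib_left ev_add)
  qed
next
  case (scal c)
  show ?case
  proof (induct r rule: update_induct)
    case const show ?case by (simp add: ev_0)
  next
    case (update r m d)
    have u: "Poly_Mapping.update m d r = r + Poly_Mapping.single m d"
      using update by (auto simp: poly_mapping_eq_iff fun_eq_iff lookup_update lookup_add lookup_single when_def in_keys_iff)
    have "scal c * Poly_Mapping.single m d = Poly_Mapping.single m (c * d)"
      by (simp add: scal_def mult_single)
    then have "ev (scal c * Poly_Mapping.single m d) = ev (scal c) * ev (Poly_Mapping.single m d)"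
      unfolding ev_scal by (simp add: ev_single s_mult mult.assoc)
    then show ?case using update by (simp add: u distrib_left ev_add)
  qed
qed (simp_all add: distrib_right ev_add mult.assoc)

lemma ev_rel_ideal:
  assumes "\<And>l r. (l, r) \<in> S \<Longrightarrow> ev l = ev r" "p \<in> rel_ideal S"
  shows "ev p = 0"
proof -
  have "rel_ideal S \<subseteq> {p. ev p = 0}"
    by (rule rel_ideal_least) (auto simp: ev_0 ev_add ev_mult ev_diff assms(1))
  then show ?thesis using assms(2) by auto
qed

end


section \<open>The homomorphism\<close>

locale qserre = 
  fixes q :: "'f::field"
  assumes q_neq_0: "q \<noteq> 0" and q_not_root: "\<And>n::nat. n > 0 \<Longrightarrow> q ^ n \<noteq> 1"
begin

abbreviation "rels \<equiv> plus_rels q"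
abbreviation "A \<equiv> gen_at rels Agen"
abbreviation "B \<equiv> gen_at rels Bgen"

sublocale serre fscal q A B by (rule serre_gen_at[OF q_neq_0 q_not_root])

lemma gt_0: "gt 0 = 1" using a_0 by (simp add: a_nth)

text \<open>The given recursion is matched against \<open>g_recursion\<close> for \<open>G\<close>;
  the other three families at \<open>n\<close> then follow from \<open>G\<close> at \<open>n\<close>
  by the definition of \<open>g\<close>, \<open>A_g\<close> and \<open>g_B\<close>.\<close>

lemma alternating_elements:
  "altG q n = at_rels rels (g n) \<and> altGt q n = at_rels rels (gt n) \<and> altWneg q n = at_rels rels (v n) \<and> altWpos q n = at_rels rels (w n)"
proof (induct n rule: less_induct)
  case (less n)
  have A: "Uq_A q = at_rels rels A" and B: "Uq_B q = at_rels rels B"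
    by (simp_all add: Uq_A_def Uq_B_def at_rels_gen_at)
  note unf = altG_def altGt_def altWneg_def altWpos_def Uq_plus_def
  note IH = less[unfolded unf, THEN conjunct1] less[unfolded unf, THEN conjunct2, THEN conjunct1]
    less[unfolded unf, THEN conjunct2, THEN conjunct2, THEN conjunct1] less[unfolded unf, THEN conjunct2, THEN conjunct2, THEN conjunct2]
  let ?U = "presented_alg rels"
  have G: "G_rec q ?U (Uq_A q) (Uq_B q) n = at_rels rels (g n)"
  proof (cases "n = 0")
    case True then show ?thesis by (subst G_rec.simps) (simp add: at_rels_simps g_0)
  next
    case False
    have 1: "(\<Oplus>\<^bsub>?U\<^esub>k\<in>{0..<n}. (q powi (int n - 1 - 2 * int k)) \<odot>\<^bsub>?U\<^esub> (Wneg_rec q ?U (Uq_A q) (Uq_B q) k \<otimes>\<^bsub>?U\<^esub> Wpos_rec q ?U (Uq_A q) (Uq_B q) (n - k - 1)))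
      = at_rels rels (\<Sum>k\<in>{0..<n}. fscal (q powi (int n - 1 - 2 * int k)) * (v k * w (n - k - 1)))"
      unfolding finsum_at_rels[OF finite_atLeastLessThan, symmetric]
      by (rule finsum_fundef_cong) (simp_all add: IH at_rels_simps)
    have 2: "(\<Oplus>\<^bsub>?U\<^esub>k\<in>{1..<n}. (q powi (int n - 2 * int k)) \<odot>\<^bsub>?U\<^esub> (G_rec q ?U (Uq_A q) (Uq_B q) k \<otimes>\<^bsub>?U\<^esub> Gt_rec q ?U (Uq_A q) (Uq_B q) (n - k)))
      = at_rels rels (\<Sum>k\<in>{1..<n}. fscal (q powi (int n - 2 * int k)) * (g k * gt (n - k)))"
      unfolding finsum_at_rels[OF finite_atLeastLessThan, symmetric]
      by (rule finsum_fundef_cong) (simp_all add: IH at_rels_simps)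
    have 3: "Wpos_rec q ?U (Uq_A q) (Uq_B q) (n - 1) = at_rels rels (w (n - 1))"
      using IH(4)[of "n - 1"] False by simp
    show ?thesis
      using g_recursion[of n] False by (subst G_rec.simps, simp only: 1 2 3 if_False) (simp only: A at_rels_simps)
  qed
  have Gt: "Gt_rec q ?U (Uq_A q) (Uq_B q) n = at_rels rels (gt n)"
  proof (cases n)
    case 0 then show ?thesis by (subst Gt_rec.simps) (simp add: at_rels_simps gt_0)
  next
    case (Suc k)
    have "q powi (-2) = inverse q * inverse q" by (simp add: power_int_minus power2_eq_square)
    then have gt: "gt n = g n + fscal (inverse (1 - q powi (-2))) * (A * w k - w k * A)"
      using g_Suc[of k] by (simp add: Suc a_nth)
    have W: "Wpos_rec q ?U (Uq_A q) (Uq_B q) (n - 1) = at_rels rels (w k)"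
      using IH(4)[of k] Suc by simp
    have "n \<noteq> 0" using Suc by simp
    then show ?thesis
      by (subst Gt_rec.simps, simp only: G W if_False) (simp add: gt A at_rels_simps)
  qed
  have c: "fscal (inverse (q - inverse q)) * (fscal (q - inverse q) * z) = z" for z :: "('f, plus_gen) presented_family"
    by (rule s_inverse_cancel'[OF q_neq])
  have vn: "v n = fscal (inverse (q - inverse q)) * (Q * (A * g n) - P * (g n * A))"
    using c[of "v n"] A_g[of n] by (simp add: s_diff mult.assoc)
  have wn: "w n = fscal (inverse (q - inverse q)) * (Q * (g n * B) - P * (B * g n))"
    using c[of "w n"] g_B[of n] by (simp add: s_diff mult.assoc)
  have V: "Wneg_rec q ?U (Uq_A q) (Uq_B q) n = at_rels rels (v n)"
    by (subst Wneg_rec.simps, simp only: G) (simp add: A at_rels_simps v_0 vn[symmetric])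
  have W: "Wpos_rec q ?U (Uq_A q) (Uq_B q) n = at_rels rels (w n)"
    by (subst Wpos_rec.simps, simp only: G) (simp add: B at_rels_simps w_0 wn[symmetric])
  show ?case unfolding unf using G Gt V W by blast
qed

definition alt_image :: "alt_gen \<Rightarrow> ('f, plus_gen) presented_family" where
  "alt_image z = (case z of WnegGen k \<Rightarrow> v k | WposGen k \<Rightarrow> w k | GGen k \<Rightarrow> g (Suc k) | GtGen k \<Rightarrow> gt (Suc k))"

lemma alt_image_simps:
  "alt_image (WnegGen k) = v k" "alt_image (WposGen k) = w k" "alt_image (GGen k) = g (Suc k)" "alt_image (GtGen k) = gt (Suc k)"
  by (simp_all add: alt_image_def)

sublocale free_eval fscal alt_image ..

lemma ev_alt_rels: assumes "(l, r) \<in> alt_rels q" shows "ev l = ev r"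
proof -
  have pw: "1 - q powi (-2) = 1 - inverse q * inverse q" by (simp add: power_int_minus power2_eq_square)
  have ev_comm: "ev (comm x y) = ev x * ev y - ev y * ev x" for x y by (simp add: comm_def ev_diff ev_mult)
  have ev_qcomm: "ev (qcomm q x y) = Q * ev x * ev y - P * ev y * ev x" for x y
    by (simp add: qcomm_def ev_diff ev_mult ev_scal mult.assoc)
  note ev = ev_comm ev_qcomm ev_add ev_diff ev_mult ev_scal ev_gen ev_0 alt_image_simps pw s_1PP s_diff[of q "inverse q"]
  have r1: "ev (comm (gen (WnegGen 0)) (gen (WposGen k))) = ev (scal (1 - q powi (-2)) * (gen (GtGen k) - gen (GGen k)))" for k
    using a_g[of k] by (simp add: ev v_0 a_nth)
  have r2: "ev (comm (gen (WnegGen k)) (gen (WposGen 0))) = ev (scal (1 - q powi (-2)) * (gen (GtGen k) - gen (GGen k)))" for k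
    using a_g[of k] A_w[of k] by (simp add: ev w_0 a_nth)
  have r3: "ev (qcomm q (gen (WnegGen 0)) (gen (GGen k))) = ev (scal (q - inverse q) * gen (WnegGen (k + 1)))" for k
    using A_g[of "Suc k"] by (simp add: ev v_0)
  have r4: "ev (qcomm q (gen (GtGen k)) (gen (WnegGen 0))) = ev (scal (q - inverse q) * gen (WnegGen (k + 1)))" for k
    using v_def'[of "Suc k"] by (simp add: ev v_0 a_nth)
  have r5: "ev (qcomm q (gen (GGen k)) (gen (WposGen 0))) = ev (scal (q - inverse q) * gen (WposGen (k + 1)))" for k
    using g_B[of "Suc k"] by (simp add: ev w_0)
  have r6: "ev (qcomm q (gen (WposGen 0)) (gen (GtGen k))) = ev (scal (q - inverse q) * gen (WposGen (k + 1)))" for k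
    using w_def'[of "Suc k"] by (simp add: ev w_0 a_nth)
  have r7: "ev (comm (gen (WnegGen k)) (gen (WnegGen m))) = ev (0)" for k m
    using v_comm[of k m] by (simp add: ev)
  have r8: "ev (comm (gen (WposGen k)) (gen (WposGen m))) = ev (0)" for k m
    using w_comm[of k m] by (simp add: ev)
  have r9: "ev (comm (gen (WnegGen k)) (gen (WposGen m)) + comm (gen (WposGen k)) (gen (WnegGen m))) = ev (0)" for k m
    using v_w[of k m] by (simp add: ev algebra_simps)
  have r10: "ev (comm (gen (WnegGen k)) (gen (GGen m)) + comm (gen (GGen k)) (gen (WnegGen m))) = ev (0)" for k m
    using g_v_symmetric[of k m] by (simp add: ev algebra_simps)
  have r11: "ev (comm (gen (WnegGen k)) (gen (GtGen m)) + comm (gen (GtGen k)) (gen (WnegGen m))) = ev (0)" for k m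
    using a_v_symmetric[of k m] by (simp add: ev a_nth algebra_simps)
  have r12: "ev (comm (gen (WposGen k)) (gen (GGen m)) + comm (gen (GGen k)) (gen (WposGen m))) = ev (0)" for k m
    using g_w_symmetric[of k m] by (simp add: ev algebra_simps)
  have r13: "ev (comm (gen (WposGen k)) (gen (GtGen m)) + comm (gen (GtGen k)) (gen (WposGen m))) = ev (0)" for k m
    using a_w_symmetric[of k m] by (simp add: ev a_nth algebra_simps)
  have r14: "ev (comm (gen (GGen k)) (gen (GGen m))) = ev (0)" for k m
    using g_comm[of "Suc k" "Suc m"] by (simp add: ev)
  have r15: "ev (comm (gen (GtGen k)) (gen (GtGen m))) = ev (0)" for k m
    using a_comm[of "Suc k" "Suc m"] by (simp add: ev a_nth)
  have r16: "ev (comm (gen (GtGen k)) (gen (GGen m)) + comm (gen (GGen k)) (gen (GtGen m))) = ev (0)" for k m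
    using a_g_symmetric[of "Suc k" "Suc m"] by (simp add: ev a_nth algebra_simps)
  show ?thesis
    using assms unfolding alt_rels_def Let_def
    by (elim UnE UN_E insertE emptyE Pair_inject) (simp_all only: r1 r2 r3 r4 r5 r6 r7 r8 r9 r10 r11 r12 r13 r14 r15 r16)
qed

end

theorem lemma3p3:
  fixes q :: "'f::field"
  assumes "q \<noteq> 0"
    and "\<And>n::nat. n > 0 \<Longrightarrow> q ^ n \<noteq> 1"
  shows "\<exists>\<gamma> \<in> alg_hom (Uq_alt q) (Uq_plus q).
    (\<forall>n. \<gamma> (calWneg q n) = altWneg q n \<and> \<gamma> (calWpos q n) = altWpos q n \<and>
         \<gamma> (calG q n) = altG q n \<and> \<gamma> (calGt q n) = altGt q n) \<and>
    \<gamma> ` carrier (Uq_alt q) = carrier (Uq_plus q)"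
proof -
  interpret qserre q by unfold_locales (fact assms)+
  \<comment> \<open>The choice of representative is immaterial, since \<open>ev\<close> vanishes on
    the ideal of relations.\<close>
  define \<gamma> where "\<gamma> C = at_rels rels (ev (SOME r. C = coset (alt_rels q) r))" for C
  have \<gamma>: "\<gamma> (coset (alt_rels q) p) = at_rels rels (ev p)" for p
  proof -
    have "coset (alt_rels q) p = coset (alt_rels q) (SOME r. coset (alt_rels q) p = coset (alt_rels q) r)"
      by (rule someI) simp
    then have "p - (SOME r. coset (alt_rels q) p = coset (alt_rels q) r) \<in> rel_ideal (alt_rels q)"
      by (rule coset_eq_iff[THEN iffD1])
    then have "ev (p - (SOME r. coset (alt_rels q) p = coset (alt_rels q) r)) = 0"
      using ev_alt_rels by (rule ev_rel_ideal[rotated])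
    then show ?thesis by (simp add: \<gamma>_def ev_diff)
  qed
  have car: "carrier (presented_alg (alt_rels q)) = range (coset (alt_rels q))"
    by (rule presented_alg_simps)
  have "\<gamma> \<in> ring_hom (presented_alg (alt_rels q)) (presented_alg rels)"
  proof (rule ring_hom_memI, unfold car)
    show "\<gamma> Y \<in> carrier (presented_alg rels)" if "Y \<in> range (coset (alt_rels q))" for Y
      using that \<gamma> at_rels_carrier by auto
  next
    fix Y1 Y2 assume "Y1 \<in> range (coset (alt_rels q))" "Y2 \<in> range (coset (alt_rels q))"
    then obtain p r where "Y1 = coset (alt_rels q) p" "Y2 = coset (alt_rels q) r" by auto
    then show "\<gamma> (Y1 \<otimes>\<^bsub>presented_alg (alt_rels q)\<^esub> Y2) = \<gamma> Y1 \<otimes>\<^bsub>presented_alg rels\<^esub> \<gamma> Y2"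
      and "\<gamma> (Y1 \<oplus>\<^bsub>presented_alg (alt_rels q)\<^esub> Y2) = \<gamma> Y1 \<oplus>\<^bsub>presented_alg rels\<^esub> \<gamma> Y2"
      by (simp_all only: presented_alg_simps(2,3)[of "alt_rels q"] \<gamma> at_rels_simps(1,2) ev_mult ev_add)
  next
    show "\<gamma> \<one>\<^bsub>presented_alg (alt_rels q)\<^esub> = \<one>\<^bsub>presented_alg rels\<^esub>"
      unfolding at_rels_simps(5)[of rels] presented_alg_simps(4)[of "alt_rels q"] \<gamma> ev_1 ..
  qed
  moreover have "\<gamma> (c \<odot>\<^bsub>presented_alg (alt_rels q)\<^esub> coset (alt_rels q) p) = c \<odot>\<^bsub>presented_alg rels\<^esub> \<gamma> (coset (alt_rels q) p)" for c p
    by (simp add: smult_coset \<gamma> at_rels_simps ev_mult ev_scal)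
  ultimately have "\<gamma> \<in> alg_hom (Uq_alt q) (Uq_plus q)"
    unfolding alg_hom_def Uq_alt_def Uq_plus_def car by blast
  moreover have "\<gamma> (calWneg q n) = altWneg q n \<and> \<gamma> (calWpos q n) = altWpos q n \<and>
         \<gamma> (calG q n) = altG q n \<and> \<gamma> (calGt q n) = altGt q n" for n
    using alternating_elements[of n]
    by (cases n) (simp_all add: calWneg_def calWpos_def calG_def calGt_def \<gamma> ev_gen alt_image_simps Uq_alt_def presented_alg_simps(4) ev_1 g_0 gt_0)
  moreover have "\<gamma> ` carrier (Uq_alt q) = carrier (Uq_plus q)"
  proof
    show "\<gamma> ` carrier (Uq_alt q) \<subseteq> carrier (Uq_plus q)"
      by (auto simp: Uq_alt_def Uq_plus_def presented_alg_simps(1) \<gamma> at_rels_carrier[unfolded presented_alg_simps(1)])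
    \<comment> \<open>Surjectivity: the image is a subalgebra containing the generators
      \<open>A\<close> and \<open>B\<close>, the images of the alternating generators of index 0 and
      1.\<close>
    have "\<exists>r. coset rels p = at_rels rels (ev r)" for p
    proof (induct p rule: free_alg_induct)
      case (gen x)
      have "coset rels (gen x) = at_rels rels (ev (gen (case x of Agen \<Rightarrow> WnegGen 0 | Bgen \<Rightarrow> WposGen 0)))"
        by (cases x) (simp_all add: ev_gen alt_image_simps v_0 w_0 at_rels_gen_at)
      then show ?case ..
    next
      case (scal c)
      have "coset rels (scal c) = at_rels rels (ev (scal c))"
        unfolding ev_scal by transfer simp
      then show ?case ..
    next
      case (add p r)
      then show ?case by (metis at_rels_simps(2) ev_add presented_alg_simps(3))
    next
      case (mult p r)
      then show ?case by (metis at_rels_simps(1) ev_mult presented_alg_simps(2))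
    qed
    then show "carrier (Uq_plus q) \<subseteq> \<gamma> ` carrier (Uq_alt q)"
      by (force simp: Uq_alt_def Uq_plus_def presented_alg_simps(1) \<gamma> image_image)
  qed
  ultimately show ?thesis by blast
qed

end
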